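(* Let $G$ be a finite group, $H<G$ a subgroup, and $\rho\in\mathrm{Irr}(G)$. Suppose $\rho(1)\ge |G|^{1/2}/a$ for some real number $a\ge 1$. Then there exists $\pi\in\mathrm{Irr}(H)$ such that $$\pi(1)\;\ge\;\frac{|H|^{1/2}}{a\cdot k(H)}\qquad\text{and}\qquad c(\rho,\pi)\;\ge\;\frac{[G:H]^{1/2}}{a\cdot k(H)}.$$
   Context: For a finite group $G$, $\mathrm{Irr}(G)$ is the set of irreducible complex characters of $G$ and $k(G)=|\mathrm{Irr}(G)|$ is the number of conjugacy classes of $G$ (similarly for $H$). For a subgroup $H<G$, $\rho\in\mathrm{Irr}(G)$ and $\pi\in\mathrm{Irr}(H)$, the induced multiplicity $c(\rho,\pi)$ is the multiplicity of $\rho$ in the induced character $\mathrm{Ind}_H^G\pi$, i.e. $\mathrm{Ind}_H^G\pi=\sum_{\rho\in\mathrm{Irr}(G)}c(\rho,\pi)\,\rho$ (equivalently, the multiplicity of $\pi$ in the restriction of $\rho$ to $H$). *)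

theory Defs
  imports
    "HOL-Algebra.Coset"
    "Jordan_Normal_Form.VS_Connect"
begin

definition GL :: "nat \<Rightarrow> complex mat monoid" where
  "GL n = units_of (ring_mat TYPE(complex) n ())"

definition representation :: "('a, 'b) monoid_scheme \<Rightarrow> nat \<Rightarrow> ('a \<Rightarrow> complex mat) \<Rightarrow> bool" where
  "representation G n R \<longleftrightarrow> R \<in> hom G (GL n)"

definition invariant_subspace ::
  "('a, 'b) monoid_scheme \<Rightarrow> nat \<Rightarrow> ('a \<Rightarrow> complex mat) \<Rightarrow> complex vec set \<Rightarrow> bool" where
  "invariant_subspace G n R W \<longleftrightarrow>
     VectorSpace.subspace class_ring W (module_vec TYPE(complex) n) \<and>
     (\<forall>g\<in>carrier G. \<forall>w\<in>W. R g *\<^sub>v w \<in> W)"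

definition irreducible_representation ::
  "('a, 'b) monoid_scheme \<Rightarrow> nat \<Rightarrow> ('a \<Rightarrow> complex mat) \<Rightarrow> bool" where
  "irreducible_representation G n R \<longleftrightarrow>
     representation G n R \<and> n > 0 \<and>
     (\<forall>W. invariant_subspace G n R W \<longrightarrow> W = {0\<^sub>v n} \<or> W = carrier_vec n)"

definition mat_trace :: "complex mat \<Rightarrow> complex" where
  "mat_trace A = (\<Sum>i<dim_row A. A $$ (i, i))"

(* Class functions are restricted to the carrier, so that two characters which agree
   on the group are equal as HOL functions and Irr G can be counted. *)
definition rep_character :: "('a, 'b) monoid_scheme \<Rightarrow> ('a \<Rightarrow> complex mat) \<Rightarrow> 'a \<Rightarrow> complex" where
  "rep_character G R = (\<lambda>g\<in>carrier G. mat_trace (R g))"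

definition Irr :: "('a, 'b) monoid_scheme \<Rightarrow> ('a \<Rightarrow> complex) set" where
  "Irr G = {rep_character G R |R n. irreducible_representation G n R}"

definition k_number :: "('a, 'b) monoid_scheme \<Rightarrow> nat" where
  "k_number G = card (Irr G)"

(* A character value at the identity is a positive integer, viewed as a complex number;
   taking the real part only changes its type. *)
definition char_degree :: "('a, 'b) monoid_scheme \<Rightarrow> ('a \<Rightarrow> complex) \<Rightarrow> real" where
  "char_degree G \<chi> = Re (\<chi> \<one>\<^bsub>G\<^esub>)"

definition induced_character ::
  "('a, 'b) monoid_scheme \<Rightarrow> 'a set \<Rightarrow> ('a \<Rightarrow> complex) \<Rightarrow> 'a \<Rightarrow> complex" where
  "induced_character G H \<chi> = (\<lambda>g\<in>carrier G.
     (\<Sum>x\<in>carrier G.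
        if inv\<^bsub>G\<^esub> x \<otimes>\<^bsub>G\<^esub> g \<otimes>\<^bsub>G\<^esub> x \<in> H then \<chi> (inv\<^bsub>G\<^esub> x \<otimes>\<^bsub>G\<^esub> g \<otimes>\<^bsub>G\<^esub> x) else 0)
     / of_nat (card H))"

(* The family of multiplicities in the decomposition of a character into irreducible
   characters. Requiring value 0 outside Irr G makes the family unique. *)
definition irr_multiplicities ::
  "('a, 'b) monoid_scheme \<Rightarrow> ('a \<Rightarrow> complex) \<Rightarrow> ('a \<Rightarrow> complex) \<Rightarrow> nat" where
  "irr_multiplicities G \<phi> =
     (THE m. (\<forall>\<chi>. \<chi> \<notin> Irr G \<longrightarrow> m \<chi> = 0) \<and>
             (\<forall>g\<in>carrier G. \<phi> g = (\<Sum>\<chi>\<in>Irr G. of_nat (m \<chi>) * \<chi> g)))"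

definition induced_multiplicity ::
  "('a, 'b) monoid_scheme \<Rightarrow> 'a set \<Rightarrow> ('a \<Rightarrow> complex) \<Rightarrow> ('a \<Rightarrow> complex) \<Rightarrow> nat" where
  "induced_multiplicity G H \<rho> \<pi> = irr_multiplicities G (induced_character G H \<pi>) \<rho>"

end

theory Submission
  imports Defs "Jordan_Normal_Form.Spectral_Radius"
begin

text \<open>Restricting \<open>\<rho>\<close> to \<open>H\<close> gives \<open>\<rho>(1) = \<Sum>\<pi>. c(\<rho>, \<pi>) \<pi>(1)\<close> with \<open>k(H)\<close> summands, so some \<open>\<pi>\<close>
  satisfies \<open>c(\<rho>, \<pi>) \<pi>(1) \<ge> \<rho>(1) / k(H)\<close>. It remains to bound each factor from above:
  \<open>\<pi>(1)\<^sup>2 \<le> |H|\<close> because the squares of the degrees sum to \<open>|H|\<close>, and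
  \<open>c(\<rho>, \<pi>)\<^sup>2 \<le> [G:H]\<close> by multiplying \<open>c(\<rho>, \<pi>) \<pi>(1) \<le> \<rho>(1)\<close> with
  \<open>c(\<rho>, \<pi>) \<rho>(1) \<le> [G:H] \<pi>(1)\<close>, the latter from Frobenius reciprocity and the degree of the
  induced character. The regular representation yields the finiteness of the set of irreducible
  characters, the sum of squares of their degrees and their completeness among class functions.
  Completeness makes the induced character a combination of irreducible characters, with natural
  coefficients by reciprocity, without an induced representation.\<close>

section \<open>Matrices and subspaces of coordinate space\<close>

lemma mult_mat_entry:
  fixes A B :: "'a :: comm_semiring_0 mat"
  assumes "A \<in> carrier_mat n m" "B \<in> carrier_mat m k" "i < n" "j < k"
  shows "(A * B) $$ (i, j) = (\<Sum>p<m. A $$ (i, p) * B $$ (p, j))"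
  using assms by (auto simp: scalar_prod_def lessThan_atLeast0)

lemma mult_mat_vec_entry:
  fixes A :: "'a :: comm_semiring_0 mat"
  assumes "A \<in> carrier_mat n m" "v \<in> carrier_vec m" "i < n"
  shows "(A *\<^sub>v v) $ i = (\<Sum>p<m. A $$ (i, p) * v $ p)"
  using assms by (auto simp: scalar_prod_def lessThan_atLeast0)

lemma mult_mat_unit_vec:
  fixes A :: "'a :: comm_semiring_1 mat"
  assumes A: "A \<in> carrier_mat n m" and j: "j < m"
  shows "A *\<^sub>v unit_vec m j = col A j"
proof (rule eq_vecI)
  fix i assume "i < dim_vec (col A j)"
  then have i: "i < n" using A by simp
  have "(A *\<^sub>v unit_vec m j) $ i = (\<Sum>p<m. A $$ (i, p) * unit_vec m j $ p)"
    using A i by (intro mult_mat_vec_entry) auto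
  also have "\<dots> = (\<Sum>p<m. if p = j then A $$ (i, j) else 0)"
    using j by (intro sum.cong) (auto simp: unit_vec_def)
  finally show "(A *\<^sub>v unit_vec m j) $ i = col A j $ i" using A i j by simp
qed (use A in auto)

lemma mat_eq_if_mult_vec_eq:
  fixes A B :: "'a :: comm_semiring_1 mat"
  assumes A: "A \<in> carrier_mat n m" and B: "B \<in> carrier_mat n m"
    and eq: "\<And>v. v \<in> carrier_vec m \<Longrightarrow> A *\<^sub>v v = B *\<^sub>v v"
  shows "A = B"
proof (rule eq_matI)
  fix i j assume "i < dim_row B" "j < dim_col B"
  then have ij: "i < n" "j < m" using B by auto
  show "A $$ (i, j) = B $$ (i, j)"
    using mult_mat_unit_vec[OF A ij(2)] mult_mat_unit_vec[OF B ij(2)] eq[of "unit_vec m j"] A B ij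
    by (metis index_col carrier_matD unit_vec_carrier)
qed (use A B in auto)

text \<open>The factors may be rectangular. This is what turns the trace of a projection
  \<open>A * B\<close> into the size of the identity matrix \<open>B * A\<close>, and the trace of a
  block into the trace of a full-size product.\<close>

lemma mat_trace_mult_comm:
  assumes A: "A \<in> carrier_mat n m" and B: "B \<in> carrier_mat m n"
  shows "mat_trace (A * B) = mat_trace (B * A)"
proof -
  have "mat_trace (A * B) = (\<Sum>i<n. \<Sum>p<m. A $$ (i, p) * B $$ (p, i))"
    unfolding mat_trace_def using A B mult_mat_entry[OF A B] by auto
  also have "\<dots> = (\<Sum>p<m. \<Sum>i<n. B $$ (p, i) * A $$ (i, p))"
    by (subst sum.swap) (simp add: mult.commute)
  also have "\<dots> = mat_trace (B * A)"
    unfolding mat_trace_def using A B mult_mat_entry[OF B A] by auto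
  finally show ?thesis .
qed

lemma mat_trace_add:
  "A \<in> carrier_mat n n \<Longrightarrow> B \<in> carrier_mat n n \<Longrightarrow> mat_trace (A + B) = mat_trace A + mat_trace B"
  unfolding mat_trace_def by (auto simp: sum.distrib)

lemma mat_trace_one: "mat_trace (1\<^sub>m n) = of_nat n"
  unfolding mat_trace_def by simp

section \<open>Subspaces of coordinate space and their bases\<close>

lemma subspace_vecI:
  fixes W :: "'a :: field vec set"
  assumes "W \<subseteq> carrier_vec n" "0\<^sub>v n \<in> W"
    and "\<And>v w. v \<in> W \<Longrightarrow> w \<in> W \<Longrightarrow> v + w \<in> W"
    and "\<And>c v. v \<in> W \<Longrightarrow> c \<cdot>\<^sub>v v \<in> W"
  shows "VectorSpace.subspace class_ring W (module_vec TYPE('a) n)"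
  unfolding VectorSpace.subspace_def LinearCombinations.submodule_def
  using vec_vs vec_module assms by (auto simp: module_vec_simps)

lemma subspace_vecD:
  fixes W :: "'a :: field vec set"
  assumes "VectorSpace.subspace class_ring W (module_vec TYPE('a) n)"
  shows "W \<subseteq> carrier_vec n" "0\<^sub>v n \<in> W"
    and "\<And>v w. v \<in> W \<Longrightarrow> w \<in> W \<Longrightarrow> v + w \<in> W"
    and "\<And>c v. v \<in> W \<Longrightarrow> c \<cdot>\<^sub>v v \<in> W"
  using assms unfolding VectorSpace.subspace_def LinearCombinations.submodule_def by (auto simp: module_vec_simps)

text \<open>If \<open>n < k\<close>, padding \<open>A\<close> with zero rows and \<open>B\<close>
  with zero columns to size \<open>k\<close> leaves \<open>B * A = 1\<close> unchanged. For square
  matrices the left inverse is also a right inverse, but a zero row of the padded \<open>A\<close>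
  forces a zero on the diagonal of the reversed product.\<close>

lemma left_inverse_dim_le:
  fixes A :: "'a :: field mat"
  assumes A: "A \<in> carrier_mat n k" and B: "B \<in> carrier_mat k n" and BA: "B * A = 1\<^sub>m k"
  shows "k \<le> n"
proof (rule ccontr)
  assume "\<not> k \<le> n"
  then have nk: "n < k" by simp
  define A' where "A' = mat k k (\<lambda>(i, j). if i < n then A $$ (i, j) else 0)"
  define B' where "B' = mat k k (\<lambda>(i, j). if j < n then B $$ (i, j) else 0)"
  have carr: "A' \<in> carrier_mat k k" "B' \<in> carrier_mat k k" unfolding A'_def B'_def by auto
  have "B' * A' = B * A"
  proof (rule eq_matI)
    fix i j assume "i < dim_row (B * A)" "j < dim_col (B * A)"
    then have ij: "i < k" "j < k" using A B by auto
    have "(B' * A') $$ (i, j) = (\<Sum>p<k. if p < n then B $$ (i, p) * A $$ (p, j) else 0)"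
      by (subst mult_mat_entry[OF carr(2,1) ij]) (auto simp: A'_def B'_def ij intro!: sum.cong)
    also have "\<dots> = (\<Sum>p<n. B $$ (i, p) * A $$ (p, j))"
      using nk by (intro sum.mono_neutral_cong_right) auto
    finally show "(B' * A') $$ (i, j) = (B * A) $$ (i, j)" by (simp only: mult_mat_entry[OF B A ij])
  qed (use A B carr in auto)
  with BA have "A' * B' = 1\<^sub>m k"
    using mat_mult_left_right_inverse[OF carr(2,1)] by simp
  then have "(A' * B') $$ (n, n) = 1" using nk by simp
  moreover have "(A' * B') $$ (n, n) = 0"
    by (subst mult_mat_entry[OF carr nk nk]) (auto simp: A'_def nk)
  ultimately show False by simp
qed

text \<open>The columns of \<open>A\<close> form a basis of \<open>W\<close>, and \<open>B\<close> reads off the coordinates.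
  They are obtained by extending a partial basis until it is maximal.\<close>

lemma subspace_basis_mat:
  fixes W :: "'a :: field vec set"
  assumes "VectorSpace.subspace class_ring W (module_vec TYPE('a) n)"
  obtains k A B where "A \<in> carrier_mat n k" "B \<in> carrier_mat k n" "B * A = 1\<^sub>m k"
    "\<And>v. v \<in> carrier_vec k \<Longrightarrow> A *\<^sub>v v \<in> W" "\<And>w. w \<in> W \<Longrightarrow> A *\<^sub>v (B *\<^sub>v w) = w"
proof -
  note W = subspace_vecD[OF assms]
  define P where "P k \<longleftrightarrow> (\<exists>A B. A \<in> carrier_mat n k \<and> B \<in> carrier_mat k n \<and> B * A = 1\<^sub>m k \<and>
    (\<forall>v\<in>carrier_vec k. A *\<^sub>v v \<in> W))" for k
  have "P 0"
  proof -
    have "0\<^sub>m 0 n * 0\<^sub>m n 0 = (1\<^sub>m 0 :: 'a mat)" by (rule eq_matI) auto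
    moreover have "0\<^sub>m n 0 *\<^sub>v v \<in> W" if "v \<in> carrier_vec 0" for v
    proof -
      have "0\<^sub>m n 0 *\<^sub>v v = 0\<^sub>v n" using that by (intro eq_vecI) (auto simp: scalar_prod_def)
      then show ?thesis using W(2) by simp
    qed
    ultimately show ?thesis unfolding P_def by (intro exI[of _ "0\<^sub>m n 0"] exI[of _ "0\<^sub>m 0 n"]) auto
  qed
  moreover have bound: "k \<le> n" if "P k" for k
    using that left_inverse_dim_le unfolding P_def by blast
  ultimately obtain k where Pk: "P k" and max: "\<And>l. P l \<Longrightarrow> l \<le> k"
    using GreatestI_nat[of P 0 n] Greatest_le_nat[of P _ n] by blast
  from Pk obtain A B where A: "A \<in> carrier_mat n k" and B: "B \<in> carrier_mat k n"
    and BA: "B * A = 1\<^sub>m k" and AW: "\<And>v. v \<in> carrier_vec k \<Longrightarrow> A *\<^sub>v v \<in> W"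
    unfolding P_def by blast
  have "A *\<^sub>v (B *\<^sub>v w) = w" if w: "w \<in> W" for w
  proof (rule ccontr)
    assume ne: "A *\<^sub>v (B *\<^sub>v w) \<noteq> w"
    have wc: "w \<in> carrier_vec n" using W w by auto
    have Bw: "B *\<^sub>v w \<in> carrier_vec k" using B wc by auto
    \<comment> \<open>The component of \<open>w\<close> along the kernel of \<open>B\<close>: a
      nonzero vector of \<open>W\<close> with zero coordinates in the present basis. It becomes the
      next basis vector.\<close>
    define u where "u = w + (-1) \<cdot>\<^sub>v (A *\<^sub>v (B *\<^sub>v w))"
    have uW: "u \<in> W" unfolding u_def using W w AW[OF Bw] by blast
    have uc: "u \<in> carrier_vec n" using uW W by auto
    have Bu: "B *\<^sub>v u = 0\<^sub>v k"
    proof -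
      have "B *\<^sub>v u = B *\<^sub>v w + (-1) \<cdot>\<^sub>v (B *\<^sub>v (A *\<^sub>v (B *\<^sub>v w)))"
        unfolding u_def using A B wc Bw
        by (simp add: mult_add_distrib_mat_vec[OF B] mult_mat_vec[OF B])
      also have "B *\<^sub>v (A *\<^sub>v (B *\<^sub>v w)) = (B * A) *\<^sub>v (B *\<^sub>v w)"
        using A B Bw by simp
      also have "\<dots> = B *\<^sub>v w" using BA Bw by simp
      finally show ?thesis using Bw B by (intro eq_vecI) (auto simp del: index_mult_mat_vec)
    qed
    obtain p where p: "p < n" "u $ p \<noteq> 0"
    proof (rule ccontr)
      assume "\<not> thesis"
      then have z: "u $ p = 0" if "p < n" for p using that \<open>\<And>p. p < n \<Longrightarrow> u $ p \<noteq> 0 \<Longrightarrow> thesis\<close> by blast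
      have "A *\<^sub>v (B *\<^sub>v w) = w"
      proof (rule eq_vecI)
        fix i assume "i < dim_vec w"
        then have "i < n" using wc by auto
        then show "(A *\<^sub>v (B *\<^sub>v w)) $ i = w $ i"
          using z[of i] wc A Bw unfolding u_def by (auto simp del: index_mult_mat_vec)
      qed (use A wc in auto)
      then show False using ne by simp
    qed
    \<comment> \<open>The row of the functional sending \<open>v\<close> to entry \<open>p\<close>
      of \<open>v - A (B v)\<close>, divided by \<open>u $ p\<close>. It vanishes on the columns of
      \<open>A\<close> and is 1 at \<open>u\<close>, so it reads off the coordinate of the new basis
      vector.\<close>
    define \<phi> where "\<phi> = (\<lambda>j. ((if j = p then 1 else 0) - (A * B) $$ (p, j)) / u $ p)"
    define A' where "A' = mat n (Suc k) (\<lambda>(i, j). if j < k then A $$ (i, j) else u $ i)"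
    define B' where "B' = mat (Suc k) n (\<lambda>(i, j). if i < k then B $$ (i, j) else \<phi> j)"
    have carr: "A' \<in> carrier_mat n (Suc k)" "B' \<in> carrier_mat (Suc k) n"
      unfolding A'_def B'_def by auto
    have AB: "A * B \<in> carrier_mat n n" using A B by auto
    have \<phi>v: "(\<Sum>q<n. \<phi> q * v $ q) = (v $ p - (A *\<^sub>v (B *\<^sub>v v)) $ p) / u $ p"
      if v: "v \<in> carrier_vec n" for v
    proof -
      have "(\<Sum>q<n. \<phi> q * v $ q) =
          ((\<Sum>q<n. (if q = p then v $ p else 0)) - (\<Sum>q<n. (A * B) $$ (p, q) * v $ q)) / u $ p"
        unfolding \<phi>_def sum_subtractf[symmetric] sum_divide_distrib
        by (intro sum.cong) (auto simp: field_simps)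
      also have "(\<Sum>q<n. (A * B) $$ (p, q) * v $ q) = ((A * B) *\<^sub>v v) $ p"
        using mult_mat_vec_entry[OF AB v p(1)] by simp
      also have "(A * B) *\<^sub>v v = A *\<^sub>v (B *\<^sub>v v)" using A B v by simp
      finally show ?thesis using p by simp
    qed
    have \<phi>u: "(\<Sum>q<n. \<phi> q * u $ q) = 1"
    proof -
      have "A *\<^sub>v 0\<^sub>v k = 0\<^sub>v n" using A by auto
      then show ?thesis using \<phi>v[OF uc] p Bu by simp
    qed
    have \<phi>A: "(\<Sum>q<n. \<phi> q * A $$ (q, j)) = 0" if j: "j < k" for j
    proof -
      have "(\<Sum>q<n. \<phi> q * A $$ (q, j)) = (\<Sum>q<n. \<phi> q * col A j $ q)"
        using A j by (intro sum.cong) auto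
      also have "\<dots> = (col A j $ p - (A *\<^sub>v (B *\<^sub>v col A j)) $ p) / u $ p"
        using A j by (intro \<phi>v) auto
      also have "B *\<^sub>v col A j = col (B * A) j" using A B j by auto
      also have "\<dots> = unit_vec k j" using BA j by simp
      also have "A *\<^sub>v unit_vec k j = col A j" using mult_mat_unit_vec[OF A j] .
      finally show ?thesis by simp
    qed
    have "B' * A' = 1\<^sub>m (Suc k)"
    proof (rule eq_matI)
      fix i j assume "i < dim_row (1\<^sub>m (Suc k))" "j < dim_col (1\<^sub>m (Suc k))"
      then have ij: "i < Suc k" "j < Suc k" by auto
      have e: "(B' * A') $$ (i, j) = (\<Sum>q<n. (if i < k then B $$ (i, q) else \<phi> q) *
          (if j < k then A $$ (q, j) else u $ q))"
        by (subst mult_mat_entry[OF carr(2,1) ij]) (auto simp: A'_def B'_def ij intro!: sum.cong)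
      \<comment> \<open>The four blocks of the product are \<open>B * A = 1\<close>,
        \<open>B u = 0\<close>, \<open>\<phi> A = 0\<close> and \<open>\<phi> u = 1\<close>.\<close>
      consider "i < k" "j < k" | "i < k" "j = k" | "i = k" "j < k" | "i = k" "j = k"
        using ij by linarith
      then show "(B' * A') $$ (i, j) = 1\<^sub>m (Suc k) $$ (i, j)"
      proof cases
        case 1
        then show ?thesis using e mult_mat_entry[OF B A 1] BA by simp
      next
        case 2
        then show ?thesis using e mult_mat_vec_entry[OF B uc 2(1)] Bu by simp
      next
        case 3
        then show ?thesis using e \<phi>A by simp
      next
        case 4
        then show ?thesis using e \<phi>u by simp
      qed
    qed (use carr in auto)
    moreover have "A' *\<^sub>v v \<in> W" if v: "v \<in> carrier_vec (Suc k)" for v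
    proof -
      define v' where "v' = vec k (\<lambda>i. v $ i)"
      have v': "v' \<in> carrier_vec k" unfolding v'_def by simp
      have "A' *\<^sub>v v = A *\<^sub>v v' + v $ k \<cdot>\<^sub>v u"
      proof (rule eq_vecI)
        fix i assume "i < dim_vec (A *\<^sub>v v' + v $ k \<cdot>\<^sub>v u)"
        then have i: "i < n" using uc by simp
        have "(A' *\<^sub>v v) $ i = (\<Sum>q<k. A $$ (i, q) * v' $ q) + u $ i * v $ k"
          by (subst mult_mat_vec_entry[OF carr(1) v i]) (auto simp: A'_def v'_def i)
        also have "\<dots> = (A *\<^sub>v v') $ i + u $ i * v $ k"
          using mult_mat_vec_entry[OF A v' i] by simp
        finally show "(A' *\<^sub>v v) $ i = (A *\<^sub>v v' + v $ k \<cdot>\<^sub>v u) $ i"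
          using i uc A by (simp add: mult.commute)
      qed (use carr uc in auto)
      then show ?thesis using W(3)[OF AW[OF v'] W(4)[OF uW]] by simp
    qed
    ultimately have "P (Suc k)" unfolding P_def using carr by blast
    then show False using max by force
  qed
  then show ?thesis using that A B BA AW by blast
qed

section \<open>Characters as sums of irreducible characters\<close>

locale finite_group = group +
  assumes fin [simp]: "finite (carrier G)"

section \<open>Matrix representations and invariant subspaces\<close>

lemma (in group) representationD:
  assumes "representation G n R"
  shows "\<And>g. g \<in> carrier G \<Longrightarrow> R g \<in> carrier_mat n n"
    and "\<And>g h. g \<in> carrier G \<Longrightarrow> h \<in> carrier G \<Longrightarrow> R (g \<otimes> h) = R g * R h"
    and "R \<one> = 1\<^sub>m n"
proof -
  interpret M: ring "ring_mat TYPE(complex) n ()" by (rule ring_mat)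
  have hom: "R \<in> hom G (GL n)" using assms unfolding representation_def .
  have carr: "carrier (GL n) \<subseteq> carrier_mat n n"
    unfolding GL_def units_of_def Units_def by (auto simp: ring_mat_simps)
  show "R g \<in> carrier_mat n n" if "g \<in> carrier G" for g
    using hom_in_carrier[OF hom that] carr by blast
  show "R (g \<otimes> h) = R g * R h" if "g \<in> carrier G" "h \<in> carrier G" for g h
    using hom_mult[OF hom that] by (simp add: GL_def units_of_def ring_mat_simps)
  have "group (GL n)" unfolding GL_def by (rule M.units_group)
  then have "R \<one> = \<one>\<^bsub>GL n\<^esub>" using hom_one[OF hom] by simp
  then show "R \<one> = 1\<^sub>m n" by (simp add: GL_def units_of_def ring_mat_simps)
qed

text \<open>Invertibility of \<open>R g\<close> follows from the other conditions, with
  \<open>R (inv g)\<close> as the inverse.\<close>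

lemma (in group) representationI:
  assumes carr: "\<And>g. g \<in> carrier G \<Longrightarrow> R g \<in> carrier_mat n n"
    and mult: "\<And>g h. g \<in> carrier G \<Longrightarrow> h \<in> carrier G \<Longrightarrow> R (g \<otimes> h) = R g * R h"
    and one: "R \<one> = 1\<^sub>m n"
  shows "representation G n R"
proof -
  have "R g \<in> carrier (GL n)" if g: "g \<in> carrier G" for g
  proof -
    have "R g * R (inv g) = 1\<^sub>m n" "R (inv g) * R g = 1\<^sub>m n"
      using mult[of g "inv g"] mult[of "inv g" g] one g by simp_all
    then show ?thesis
      using carr g unfolding GL_def units_of_def Units_def by (auto simp: ring_mat_simps)
  qed
  then show ?thesis
    unfolding representation_def
    by (auto intro!: homI simp: mult) (simp add: GL_def units_of_def ring_mat_simps)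
qed

lemma invariant_subspaceI:
  assumes "W \<subseteq> carrier_vec n" "0\<^sub>v n \<in> W"
    and "\<And>v w. v \<in> W \<Longrightarrow> w \<in> W \<Longrightarrow> v + w \<in> W"
    and "\<And>c v. v \<in> W \<Longrightarrow> c \<cdot>\<^sub>v v \<in> W"
    and "\<And>g w. g \<in> carrier G \<Longrightarrow> w \<in> W \<Longrightarrow> R g *\<^sub>v w \<in> W"
  shows "invariant_subspace G n R W"
  unfolding invariant_subspace_def using assms by (auto intro: subspace_vecI)

lemma irreducible_representationD:
  assumes "irreducible_representation G n R"
  shows "representation G n R" "n > 0"
    and "\<And>W. invariant_subspace G n R W \<Longrightarrow> W \<noteq> {0\<^sub>v n} \<Longrightarrow> W = carrier_vec n"
  using assms unfolding irreducible_representation_def by auto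

section \<open>Splitting characters into irreducible ones\<close>

context group
begin

text \<open>Conjugating by a basis adapted to an invariant subspace makes a representation
  block triangular, and the diagonal blocks are again representations.
  No invariant complement is needed to split the character.\<close>

lemma rep_character_split:
  assumes rep: "representation G n R" and inv: "invariant_subspace G n R W"
    and W0: "W \<noteq> {0\<^sub>v n}" and W1: "W \<noteq> carrier_vec n"
  obtains k l S T where "k < n" "l < n" "representation G k S" "representation G l T"
    "\<And>g. g \<in> carrier G \<Longrightarrow> mat_trace (R g) = mat_trace (S g) + mat_trace (T g)"
proof -
  note R = representationD[OF rep]
  have sub: "VectorSpace.subspace class_ring W (module_vec TYPE(complex) n)"
    and RW: "\<And>g w. g \<in> carrier G \<Longrightarrow> w \<in> W \<Longrightarrow> R g *\<^sub>v w \<in> W"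
    using inv unfolding invariant_subspace_def by auto
  note W = subspace_vecD[OF sub]
  obtain k A B where A: "A \<in> carrier_mat n k" and B: "B \<in> carrier_mat k n"
    and BA: "B * A = 1\<^sub>m k" and AW: "\<And>v. v \<in> carrier_vec k \<Longrightarrow> A *\<^sub>v v \<in> W"
    and ABw: "\<And>w. w \<in> W \<Longrightarrow> A *\<^sub>v (B *\<^sub>v w) = w"
    by (rule subspace_basis_mat[OF sub]) (rule that)
  have ABc: "A * B \<in> carrier_mat n n" using A B by simp
  \<comment> \<open>\<open>A * B\<close> is a projection onto \<open>W\<close>; \<open>E\<close> is
    the complementary projection, onto the kernel \<open>U\<close> of \<open>B\<close>.\<close>
  define E where "E = 1\<^sub>m n - A * B"
  have E: "E \<in> carrier_mat n n" unfolding E_def by (rule minus_carrier_mat[OF ABc])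
  define U where "U = {v \<in> carrier_vec n. B *\<^sub>v v = 0\<^sub>v k}"
  have subU: "VectorSpace.subspace class_ring U (module_vec TYPE(complex) n)"
    unfolding U_def
    by (rule subspace_vecI) (use B in \<open>auto simp: mult_add_distrib_mat_vec[OF B] mult_mat_vec[OF B]\<close>)
  obtain l C D where C: "C \<in> carrier_mat n l" and D: "D \<in> carrier_mat l n"
    and DC: "D * C = 1\<^sub>m l" and CU: "\<And>v. v \<in> carrier_vec l \<Longrightarrow> C *\<^sub>v v \<in> U"
    and CDu: "\<And>u. u \<in> U \<Longrightarrow> C *\<^sub>v (D *\<^sub>v u) = u"
    by (rule subspace_basis_mat[OF subU]) (rule that)
  have BC: "B * C = 0\<^sub>m k l"
  proof (rule mat_eq_if_mult_vec_eq)
    fix v :: "complex vec" assume v: "v \<in> carrier_vec l"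
    then have "(B * C) *\<^sub>v v = B *\<^sub>v (C *\<^sub>v v)" using B C by simp
    then show "(B * C) *\<^sub>v v = 0\<^sub>m k l *\<^sub>v v" using CU[OF v] v unfolding U_def by auto
  qed (use B C in auto)
  have BE: "B * E = 0\<^sub>m k n"
  proof -
    have "B * E = B * 1\<^sub>m n - B * (A * B)"
      unfolding E_def using B ABc by (intro mult_minus_distrib_mat) auto
    also have "B * (A * B) = (B * A) * B" using A B by simp
    finally show ?thesis using BA B by simp
  qed
  have EA: "E * A = 0\<^sub>m n k"
  proof -
    have "E * A = 1\<^sub>m n * A - (A * B) * A"
      unfolding E_def using A ABc by (intro minus_mult_distrib_mat) auto
    also have "(A * B) * A = A * (B * A)" using A B by simp
    finally show ?thesis using BA A by simp
  qed
  \<comment> \<open>Coordinates in \<open>U\<close> after projecting along \<open>W\<close>. The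
    columns of \<open>A\<close> and \<open>C\<close> together form the adapted basis, and the rows
    of \<open>B\<close> and \<open>P\<close> form its inverse.\<close>
  define P where "P = D * E"
  have P: "P \<in> carrier_mat l n" unfolding P_def using D E by simp
  have CP: "C * P = E"
  proof (rule mat_eq_if_mult_vec_eq)
    fix v :: "complex vec" assume v: "v \<in> carrier_vec n"
    have "B *\<^sub>v (E *\<^sub>v v) = (B * E) *\<^sub>v v" using B E v by simp
    then have "E *\<^sub>v v \<in> U" unfolding U_def using BE E v by auto
    moreover have "(C * P) *\<^sub>v v = C *\<^sub>v (D *\<^sub>v (E *\<^sub>v v))"
      unfolding P_def using C D E v by (simp add: assoc_mult_mat_vec[of _ n l _ n])
    ultimately show "(C * P) *\<^sub>v v = E *\<^sub>v v" using CDu by simp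
  qed (use C P E in auto)
  have EC: "E * C = C"
  proof -
    have "E * C = 1\<^sub>m n * C - (A * B) * C"
      unfolding E_def using C ABc by (intro minus_mult_distrib_mat) auto
    also have "(A * B) * C = A * (B * C)" using A B C by simp
    finally show ?thesis using BC A C by auto
  qed
  have PC: "P * C = 1\<^sub>m l"
    unfolding P_def using D E C EC DC by simp
  have PA: "P * A = 0\<^sub>m l k"
    unfolding P_def using D E A EA by simp
  have sum1: "A * B + C * P = 1\<^sub>m n"
    unfolding CP E_def using A B by (intro eq_matI) auto
  \<comment> \<open>The dimensions add up because the trace of each projection is its rank and the
    two projections sum to the identity.\<close>
  have "of_nat n = mat_trace (A * B) + mat_trace (C * P)"
    using mat_trace_add[OF ABc, of "C * P"] C P sum1 mat_trace_one[of n] by simp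
  also have "mat_trace (A * B) = of_nat k"
    using mat_trace_mult_comm[OF A B] BA by (simp add: mat_trace_one)
  also have "mat_trace (C * P) = of_nat l"
    using mat_trace_mult_comm[OF C P] PC by (simp add: mat_trace_one)
  finally have "of_nat n = (of_nat (k + l) :: complex)" by simp
  then have nkl: "n = k + l" using of_nat_eq_iff by blast
  have "k \<noteq> 0"
  proof
    assume k0: "k = 0"
    have "w = 0\<^sub>v n" if "w \<in> W" for w
    proof -
      have "A *\<^sub>v v = 0\<^sub>v n" if "v \<in> carrier_vec k" for v
        using A that k0 by (intro eq_vecI) (auto simp: scalar_prod_def)
      then show ?thesis using ABw[OF that] B W(1) that by (metis mult_mat_vec_carrier subsetD)
    qed
    then show False using W0 W(2) by blast
  qed
  moreover have "l \<noteq> 0"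
  proof
    assume l0: "l = 0"
    have "E = 0\<^sub>m n n" unfolding CP[symmetric] using C P l0 by (intro eq_matI) (auto simp: scalar_prod_def)
    then have AB1: "A * B = 1\<^sub>m n" using sum1 ABc CP by simp
    have "v \<in> W" if v: "v \<in> carrier_vec n" for v
    proof -
      have "A *\<^sub>v (B *\<^sub>v v) = v" using AB1 A B v by (metis assoc_mult_mat_vec one_mult_mat_vec)
      then show ?thesis using AW[of "B *\<^sub>v v"] B v by simp
    qed
    then show False using W1 W(1) by blast
  qed
  ultimately have kl: "k < n" "l < n" using nkl by auto
  \<comment> \<open>Invariance of \<open>W\<close> as a matrix identity: the projection
    \<open>A * B\<close> fixes the columns of \<open>R g * A\<close>, which lie in
    \<open>W\<close>.\<close>
  have RA: "A * (B * (R g * A)) = R g * A" if g: "g \<in> carrier G" for g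
  proof (rule mat_eq_if_mult_vec_eq)
    fix v :: "complex vec" assume v: "v \<in> carrier_vec k"
    have "R g *\<^sub>v (A *\<^sub>v v) \<in> W" using RW[OF g AW[OF v]] .
    then show "(A * (B * (R g * A))) *\<^sub>v v = (R g * A) *\<^sub>v v"
      using A B R(1)[OF g] v ABw by (simp add: assoc_mult_mat_vec[of _ n k _ k]
        assoc_mult_mat_vec[of _ k n _ k] assoc_mult_mat_vec[of _ n n _ k])
  qed (use A B R(1)[OF g] in auto)
  \<comment> \<open>The block of \<open>R g\<close> leading from \<open>W\<close> to
    \<open>U\<close> vanishes, so the adapted form is block triangular.\<close>
  have PRA: "P * (R g * A) = 0\<^sub>m l k" if g: "g \<in> carrier G" for g
  proof -
    have "P * (R g * A) = P * (A * (B * (R g * A)))" using RA[OF g] by simp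
    also have "\<dots> = (P * A) * (B * (R g * A))"
      using P A B R(1)[OF g] by (intro assoc_mult_mat[symmetric]) auto
    finally show ?thesis using PA B A R(1)[OF g] by simp
  qed
  \<comment> \<open>\<open>S\<close> is the action on \<open>W\<close>, and \<open>T\<close> is the
    action on the quotient by \<open>W\<close>, transported to \<open>U\<close>.\<close>
  define S where "S = (\<lambda>g. B * (R g * A))"
  define T where "T = (\<lambda>g. P * (R g * C))"
  have S: "S g \<in> carrier_mat k k" and T: "T g \<in> carrier_mat l l" if "g \<in> carrier G" for g
    unfolding S_def T_def using A B C P R(1)[OF that] by auto
  have repS: "representation G k S"
  proof (rule representationI)
    fix g h assume g: "g \<in> carrier G" and h: "h \<in> carrier G"
    have "S g * S h = B * (R g * (A * (B * (R h * A))))"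
      unfolding S_def using A B R(1)[OF g] R(1)[OF h]
      by (simp add: assoc_mult_mat[of _ k n _ k _ k] assoc_mult_mat[of _ n n _ k _ k])
    also have "\<dots> = B * ((R g * R h) * A)"
      using RA[OF h] A R(1)[OF g] R(1)[OF h] by simp
    finally show "S (g \<otimes> h) = S g * S h" unfolding S_def by (simp add: R(2) g h)
  qed (use S R(3) A BA in \<open>auto simp: S_def\<close>)
  have repT: "representation G l T"
  proof (rule representationI)
    fix g h assume g: "g \<in> carrier G" and h: "h \<in> carrier G"
    note Rg = R(1)[OF g] and Rh = R(1)[OF h]
    \<comment> \<open>The identity is inserted as \<open>A * B + C * P\<close>. In the product with
      \<open>P * R g\<close> on the left, the summand through \<open>A\<close> dies by the vanishing
      block, and only \<open>T g * T h\<close> remains.\<close>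
    have RhC: "R h * C = A * (B * (R h * C)) + C * (P * (R h * C))"
    proof -
      have X: "R h * C \<in> carrier_mat n l" using Rh C by simp
      have "R h * C = (A * B + C * P) * (R h * C)" unfolding sum1 by (rule left_mult_one_mat[OF X, symmetric])
      also have "\<dots> = (A * B) * (R h * C) + (C * P) * (R h * C)"
        using ABc C P X by (intro add_mult_distrib_mat) auto
      finally show ?thesis
        using assoc_mult_mat[OF A B X] assoc_mult_mat[OF C P X] by simp
    qed
    have BRC: "B * (R h * C) \<in> carrier_mat k l" using B Rh C by simp
    have PR: "P * R g \<in> carrier_mat l n" using P Rg by simp
    have ABRC: "A * (B * (R h * C)) \<in> carrier_mat n l" by (rule mult_carrier_mat[OF A BRC])
    have CT: "C * T h \<in> carrier_mat n l" by (rule mult_carrier_mat[OF C T[OF h]])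
    have "P * (R g * (R h * C)) = (P * R g) * (R h * C)"
      by (rule assoc_mult_mat[symmetric, OF P Rg]) (use Rh C in auto)
    also have "\<dots> = (P * R g) * (A * (B * (R h * C)) + C * T h)"
      using arg_cong[OF RhC, of "\<lambda>X. (P * R g) * X"] unfolding T_def .
    also have "\<dots> = (P * R g) * (A * (B * (R h * C))) + (P * R g) * (C * T h)"
      by (rule mult_add_distrib_mat[OF PR ABRC CT])
    also have "(P * R g) * (A * (B * (R h * C))) = ((P * R g) * A) * (B * (R h * C))"
      by (rule assoc_mult_mat[symmetric, OF PR A BRC])
    also have "(P * R g) * A = 0\<^sub>m l k"
      using PRA[OF g] assoc_mult_mat[OF P Rg A] by simp
    also have "(P * R g) * (C * T h) = ((P * R g) * C) * T h"
      by (rule assoc_mult_mat[symmetric, OF PR C T[OF h]])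
    also have "(P * R g) * C = T g"
      unfolding T_def by (rule assoc_mult_mat[OF P Rg C])
    also have "0\<^sub>m l k * (B * (R h * C)) + T g * T h = T g * T h"
      unfolding left_mult_zero_mat[OF BRC] by (rule left_add_zero_mat[OF mult_carrier_mat[OF T[OF g] T[OF h]]])
    finally have "P * (R g * (R h * C)) = T g * T h" .
    moreover have "T (g \<otimes> h) = P * (R g * (R h * C))"
      unfolding T_def R(2)[OF g h] assoc_mult_mat[OF Rg Rh C] ..
    ultimately show "T (g \<otimes> h) = T g * T h" by (rule trans[rotated])
  qed (use T R(3) C PC in \<open>auto simp: T_def\<close>)
  have "mat_trace (R g) = mat_trace (S g) + mat_trace (T g)" if g: "g \<in> carrier G" for g
  proof -
    note Rg = R(1)[OF g]
    have "R g = R g * (A * B + C * P)" unfolding sum1 by (rule right_mult_one_mat[OF Rg, symmetric])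
    also have "\<dots> = R g * (A * B) + R g * (C * P)"
      using Rg ABc C P by (intro mult_add_distrib_mat) auto
    also have "R g * (A * B) = (R g * A) * B" by (rule assoc_mult_mat[OF Rg A B, symmetric])
    also have "R g * (C * P) = (R g * C) * P" by (rule assoc_mult_mat[OF Rg C P, symmetric])
    finally have "mat_trace (R g) = mat_trace ((R g * A) * B) + mat_trace ((R g * C) * P)"
      using mat_trace_add[of "(R g * A) * B" n "(R g * C) * P"] Rg A B C P by (metis mult_carrier_mat)
    then show ?thesis
      unfolding S_def T_def
      using mat_trace_mult_comm[OF mult_carrier_mat[OF Rg A] B] mat_trace_mult_comm[OF mult_carrier_mat[OF Rg C] P]
      by (simp only:)
  qed
  then show ?thesis using that kl repS repT by blast
qed

lemma rep_character_in_Irr: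
  "irreducible_representation G n R \<Longrightarrow> rep_character G R \<in> Irr G"
  unfolding Irr_def by blast

text \<open>Strong induction on the degree: a representation of positive degree is irreducible or
  splits into two of smaller degree. A list keeps track of repeated constituents before
  \<open>Irr G\<close> is known to be finite; degree zero gives the empty list.\<close>

lemma rep_character_sum_irreducible:
  assumes "representation G n R"
  shows "\<exists>cs. set cs \<subseteq> Irr G \<and> (\<forall>g\<in>carrier G. mat_trace (R g) = (\<Sum>\<chi>\<leftarrow>cs. \<chi> g))"
  using assms
proof (induction n arbitrary: R rule: less_induct)
  case (less n)
  note R = representationD[OF less.prems]
  consider "n = 0" | "irreducible_representation G n R" |
    W where "invariant_subspace G n R W" "W \<noteq> {0\<^sub>v n}" "W \<noteq> carrier_vec n"
    using less.prems unfolding irreducible_representation_def by blast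
  then show ?case
  proof cases
    case 1
    then have "mat_trace (R g) = 0" if "g \<in> carrier G" for g
      using R(1)[OF that] unfolding mat_trace_def by auto
    then show ?thesis by (intro exI[of _ "[]"]) auto
  next
    case 2
    then show ?thesis using rep_character_in_Irr
      by (intro exI[of _ "[rep_character G R]"]) (auto simp: rep_character_def)
  next
    case 3
    obtain k l S T where "k < n" "l < n" "representation G k S" "representation G l T"
      and tr: "\<And>g. g \<in> carrier G \<Longrightarrow> mat_trace (R g) = mat_trace (S g) + mat_trace (T g)"
      using rep_character_split[OF less.prems 3] by blast
    then obtain cs ds where "set cs \<subseteq> Irr G" "set ds \<subseteq> Irr G"
      "\<forall>g\<in>carrier G. mat_trace (S g) = (\<Sum>\<chi>\<leftarrow>cs. \<chi> g)"
      "\<forall>g\<in>carrier G. mat_trace (T g) = (\<Sum>\<chi>\<leftarrow>ds. \<chi> g)"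
      using less.IH by metis
    then show ?thesis using tr by (intro exI[of _ "cs @ ds"]) auto
  qed
qed

end

section \<open>Schur's lemma\<close>

context group
begin

text \<open>A complex matrix of positive size has an eigenvalue. Since \<open>A\<close> commutes
  with the representation, the eigenspace is invariant; it is nonzero, so it is the whole
  space.\<close>

lemma schur_scalar:
  assumes irr: "irreducible_representation G n R" and A: "A \<in> carrier_mat n n"
    and comm: "\<And>g. g \<in> carrier G \<Longrightarrow> A * R g = R g * A"
  obtains c where "A = c \<cdot>\<^sub>m 1\<^sub>m n"
proof -
  note irrD = irreducible_representationD[OF irr]
  note R = representationD[OF irrD(1)]
  obtain c v where v: "v \<in> carrier_vec n" "v \<noteq> 0\<^sub>v n" "A *\<^sub>v v = c \<cdot>\<^sub>v v"
    using spectrum_non_empty[OF A irrD(2)] A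
    unfolding spectrum_def eigenvalue_def eigenvector_def by auto
  define W where "W = {v \<in> carrier_vec n. A *\<^sub>v v = c \<cdot>\<^sub>v v}"
  have "invariant_subspace G n R W"
  proof (rule invariant_subspaceI)
    fix g w assume g: "g \<in> carrier G" and "w \<in> W"
    then have w: "w \<in> carrier_vec n" "A *\<^sub>v w = c \<cdot>\<^sub>v w" unfolding W_def by auto
    have "A *\<^sub>v (R g *\<^sub>v w) = (A * R g) *\<^sub>v w"
      by (rule assoc_mult_mat_vec[OF A R(1)[OF g] w(1), symmetric])
    also have "\<dots> = R g *\<^sub>v (A *\<^sub>v w)"
      unfolding comm[OF g] by (rule assoc_mult_mat_vec[OF R(1)[OF g] A w(1)])
    also have "\<dots> = c \<cdot>\<^sub>v (R g *\<^sub>v w)"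
      unfolding w(2) by (rule mult_mat_vec[OF R(1)[OF g] w(1)])
    finally show "R g *\<^sub>v w \<in> W" unfolding W_def using R(1)[OF g] w by simp
  next
    fix v w assume "v \<in> W" "w \<in> W"
    then show "v + w \<in> W" unfolding W_def
      using mult_add_distrib_mat_vec[OF A, of v w] smult_add_distrib_vec[of v n w c] by auto
  next
    fix d v assume "v \<in> W"
    then show "d \<cdot>\<^sub>v v \<in> W" unfolding W_def
      using mult_mat_vec[OF A, of v d] by (auto simp: smult_smult_assoc mult.commute)
  qed (use A in \<open>auto simp: W_def\<close>)
  moreover have "W \<noteq> {0\<^sub>v n}" using v unfolding W_def by blast
  ultimately have W: "W = carrier_vec n" using irrD(3) by blast
  have "A = c \<cdot>\<^sub>m 1\<^sub>m n"
  proof (rule mat_eq_if_mult_vec_eq[OF A])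
    fix v :: "complex vec" assume "v \<in> carrier_vec n"
    moreover from this have "A *\<^sub>v v = c \<cdot>\<^sub>v v" using W unfolding W_def by blast
    ultimately show "A *\<^sub>v v = (c \<cdot>\<^sub>m 1\<^sub>m n) *\<^sub>v v" by auto
  qed simp
  then show ?thesis using that by blast
qed

text \<open>The kernel and the image of an intertwiner are invariant. As \<open>A\<close> is
  nonzero, irreducibility makes the kernel trivial and the image the whole space.\<close>

lemma schur_intertwiner_invertible:
  assumes irrR: "irreducible_representation G n R" and irrS: "irreducible_representation G m S"
    and A: "A \<in> carrier_mat m n" and nz: "A \<noteq> 0\<^sub>m m n"
    and comm: "\<And>g. g \<in> carrier G \<Longrightarrow> A * R g = S g * A"
  obtains B where "B \<in> carrier_mat n m" "A * B = 1\<^sub>m m" "B * A = 1\<^sub>m n"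
proof -
  note irrRD = irreducible_representationD[OF irrR] and irrSD = irreducible_representationD[OF irrS]
  note R = representationD[OF irrRD(1)] and S = representationD[OF irrSD(1)]
  have commv: "A *\<^sub>v (R g *\<^sub>v v) = S g *\<^sub>v (A *\<^sub>v v)"
    if "g \<in> carrier G" "v \<in> carrier_vec n" for g v
  proof -
    have "A *\<^sub>v (R g *\<^sub>v v) = (A * R g) *\<^sub>v v"
      by (rule assoc_mult_mat_vec[OF A R(1)[OF that(1)] that(2), symmetric])
    then show ?thesis
      unfolding comm[OF that(1)] assoc_mult_mat_vec[OF S(1)[OF that(1)] A that(2)] .
  qed
  obtain v\<^sub>0 where v0: "v\<^sub>0 \<in> carrier_vec n" "A *\<^sub>v v\<^sub>0 \<noteq> 0\<^sub>v m"
  proof (rule ccontr)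
    assume "\<not> thesis"
    then have "A *\<^sub>v v = 0\<^sub>v m" if "v \<in> carrier_vec n" for v
      using that \<open>\<And>v. v \<in> carrier_vec n \<Longrightarrow> A *\<^sub>v v \<noteq> 0\<^sub>v m \<Longrightarrow> thesis\<close> by blast
    then have "A = 0\<^sub>m m n" by (intro mat_eq_if_mult_vec_eq[OF A]) auto
    then show False using nz by simp
  qed
  define K where "K = {v \<in> carrier_vec n. A *\<^sub>v v = 0\<^sub>v m}"
  have "invariant_subspace G n R K"
  proof (rule invariant_subspaceI)
    fix g w assume g: "g \<in> carrier G" and "w \<in> K"
    then show "R g *\<^sub>v w \<in> K"
      unfolding K_def using commv[OF g] R(1)[OF g] S(1)[OF g] by auto
  qed (use A in \<open>auto simp: K_def mult_add_distrib_mat_vec[OF A] mult_mat_vec[OF A]\<close>)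
  moreover have "K \<noteq> carrier_vec n" using v0 unfolding K_def by blast
  ultimately have K: "K = {0\<^sub>v n}" using irrRD(3) by blast
  define I where "I = (\<lambda>v. A *\<^sub>v v) ` carrier_vec n"
  have "invariant_subspace G m S I"
  proof (rule invariant_subspaceI)
    show "I \<subseteq> carrier_vec m" using A unfolding I_def by auto
    have "A *\<^sub>v 0\<^sub>v n = 0\<^sub>v m" using A by auto
    then show "0\<^sub>v m \<in> I" unfolding I_def by (metis image_eqI zero_carrier_vec)
    show "v + w \<in> I" if "v \<in> I" "w \<in> I" for v w
    proof -
      obtain v' w' where "v' \<in> carrier_vec n" "w' \<in> carrier_vec n" "v = A *\<^sub>v v'" "w = A *\<^sub>v w'"
        using \<open>v \<in> I\<close> \<open>w \<in> I\<close> unfolding I_def by blast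
      then have "v + w = A *\<^sub>v (v' + w')" "v' + w' \<in> carrier_vec n"
        using mult_add_distrib_mat_vec[OF A] by simp_all
      then show ?thesis unfolding I_def by blast
    qed
    show "c \<cdot>\<^sub>v v \<in> I" if "v \<in> I" for c v
    proof -
      obtain v' where "v' \<in> carrier_vec n" "v = A *\<^sub>v v'"
        using \<open>v \<in> I\<close> unfolding I_def by blast
      then have "c \<cdot>\<^sub>v v = A *\<^sub>v (c \<cdot>\<^sub>v v')" "c \<cdot>\<^sub>v v' \<in> carrier_vec n"
        using mult_mat_vec[OF A] by simp_all
      then show ?thesis unfolding I_def by blast
    qed
    show "S g *\<^sub>v v \<in> I" if g: "g \<in> carrier G" and v: "v \<in> I" for g v
    proof -
      obtain v' where "v' \<in> carrier_vec n" "v = A *\<^sub>v v'"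
        using v unfolding I_def by blast
      then have "S g *\<^sub>v v = A *\<^sub>v (R g *\<^sub>v v')" "R g *\<^sub>v v' \<in> carrier_vec n"
        using commv[OF g] R(1)[OF g] by simp_all
      then show ?thesis unfolding I_def by blast
    qed
  qed
  moreover have "I \<noteq> {0\<^sub>v m}" using v0 unfolding I_def by blast
  ultimately have I: "I = carrier_vec m" using irrSD(3) by blast
  have "\<exists>v. v \<in> carrier_vec n \<and> A *\<^sub>v v = unit_vec m j" for j
  proof -
    have "unit_vec m j \<in> I" unfolding I by simp
    then show ?thesis unfolding I_def by force
  qed
  then obtain u where u: "\<And>j. u j \<in> carrier_vec n" "\<And>j. A *\<^sub>v u j = unit_vec m j" by metis
  \<comment> \<open>A right inverse, with preimages of the unit vectors as its columns.\<close>
  define B where "B = mat n m (\<lambda>(i, j). u j $ i)"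
  have B: "B \<in> carrier_mat n m" unfolding B_def by simp
  have AB: "A * B = 1\<^sub>m m"
  proof (rule eq_matI)
    fix i j assume "i < dim_row (1\<^sub>m m :: complex mat)" "j < dim_col (1\<^sub>m m :: complex mat)"
    then have ij: "i < m" "j < m" by auto
    have "(A * B) $$ (i, j) = (\<Sum>p<n. A $$ (i, p) * u j $ p)"
      by (subst mult_mat_entry[OF A B ij]) (auto simp: B_def ij intro!: sum.cong)
    also have "\<dots> = (A *\<^sub>v u j) $ i" by (rule mult_mat_vec_entry[OF A u(1) ij(1), symmetric])
    finally show "(A * B) $$ (i, j) = 1\<^sub>m m $$ (i, j)" using u(2) ij by simp
  qed (use A B in auto)
  have "B * A = 1\<^sub>m n"
  proof (rule mat_eq_if_mult_vec_eq)
    fix v :: "complex vec" assume v: "v \<in> carrier_vec n"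
    have Av: "A *\<^sub>v v \<in> carrier_vec m" using A v by simp
    have BAv: "B *\<^sub>v (A *\<^sub>v v) \<in> carrier_vec n" using B Av by simp
    \<comment> \<open>The right inverse is also a left inverse: \<open>A\<close> kills
      \<open>B (A v) - v\<close>, and its kernel is trivial.\<close>
    have "A *\<^sub>v (B *\<^sub>v (A *\<^sub>v v) - v) = A *\<^sub>v (B *\<^sub>v (A *\<^sub>v v)) - A *\<^sub>v v"
      by (rule mult_minus_distrib_mat_vec[OF A BAv v])
    also have "A *\<^sub>v (B *\<^sub>v (A *\<^sub>v v)) = A *\<^sub>v v"
      using assoc_mult_mat_vec[OF A B Av] AB Av by simp
    finally have "A *\<^sub>v (B *\<^sub>v (A *\<^sub>v v) - v) = 0\<^sub>v m" using Av by simp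
    then have "B *\<^sub>v (A *\<^sub>v v) - v \<in> K" unfolding K_def using BAv v by simp
    then have z: "B *\<^sub>v (A *\<^sub>v v) - v = 0\<^sub>v n" using K by simp
    have "B *\<^sub>v (A *\<^sub>v v) = v"
    proof (rule eq_vecI)
      fix i assume "i < dim_vec v"
      then have "(B *\<^sub>v (A *\<^sub>v v) - v) $ i = (B *\<^sub>v (A *\<^sub>v v)) $ i - v $ i" "i < n"
        using v by auto
      then show "(B *\<^sub>v (A *\<^sub>v v)) $ i = v $ i" using z by simp
    qed (use B v in auto)
    then show "(B * A) *\<^sub>v v = 1\<^sub>m n *\<^sub>v v" using assoc_mult_mat_vec[OF B A v] v by simp
  qed (use A B in auto)
  then show ?thesis using that B AB by blast
qed

text \<open>An invertible intertwiner would conjugate \<open>R\<close> into \<open>S\<close>, and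
  conjugate matrices have equal traces. Distinctness is phrased through characters because the
  orthogonality relations compare characters.\<close>

lemma schur_intertwiner_zero:
  assumes irrR: "irreducible_representation G n R" and irrS: "irreducible_representation G m S"
    and ne: "rep_character G R \<noteq> rep_character G S"
    and A: "A \<in> carrier_mat m n"
    and comm: "\<And>g. g \<in> carrier G \<Longrightarrow> A * R g = S g * A"
  shows "A = 0\<^sub>m m n"
proof (rule ccontr)
  assume "A \<noteq> 0\<^sub>m m n"
  from schur_intertwiner_invertible[OF irrR irrS A this comm]
  obtain B where B: "B \<in> carrier_mat n m" "A * B = 1\<^sub>m m" "B * A = 1\<^sub>m n" by blast
  have "mat_trace (S g) = mat_trace (R g)" if g: "g \<in> carrier G" for g
  proof -
    have R: "R g \<in> carrier_mat n n" and S: "S g \<in> carrier_mat m m"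
      using representationD(1) irreducible_representationD(1) irrR irrS g by blast+
    have "S g = S g * (A * B)" unfolding B(2) by (rule right_mult_one_mat[OF S, symmetric])
    also have "\<dots> = (A * R g) * B"
      unfolding comm[OF g] by (rule assoc_mult_mat[OF S A B(1), symmetric])
    also have "\<dots> = A * (R g * B)" by (rule assoc_mult_mat[OF A R B(1)])
    finally have "mat_trace (S g) = mat_trace ((R g * B) * A)"
      using mat_trace_mult_comm[OF A, of "R g * B"] R B by simp
    then show ?thesis
      unfolding assoc_mult_mat[OF R B(1) A] B(3) using R by simp
  qed
  \<comment> \<open>Both characters are \<open>undefined\<close> off the carrier, so agreement on
    the carrier makes them equal as functions.\<close>
  then show False using ne unfolding rep_character_def by (auto simp: restrict_def fun_eq_iff split: if_splits)
qed

end

section \<open>Orthogonality and class functions\<close>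

text \<open>The inverse stands in for complex conjugation, so unitarity of representations is not needed.\<close>

definition char_pairing :: "('a, 'b) monoid_scheme \<Rightarrow> ('a \<Rightarrow> complex) \<Rightarrow> ('a \<Rightarrow> complex) \<Rightarrow> complex" where
  "char_pairing G f h = (\<Sum>g\<in>carrier G. f g * h (inv\<^bsub>G\<^esub> g)) / of_nat (card (carrier G))"

lemma char_pairing_cong:
  "(\<And>g. g \<in> carrier G \<Longrightarrow> f g = f' g) \<Longrightarrow> char_pairing G f h = char_pairing G f' h"
  unfolding char_pairing_def by simp

lemma char_pairing_add:
  "char_pairing G (\<lambda>g. f g + f' g) h = char_pairing G f h + char_pairing G f' h"
  unfolding char_pairing_def by (simp add: sum.distrib add_divide_distrib distrib_right)

lemma char_pairing_smult:
  "char_pairing G (\<lambda>g. c * f g) h = c * char_pairing G f h"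
  unfolding char_pairing_def by (simp add: sum_distrib_left mult.assoc)

lemma char_pairing_sum:
  "finite X \<Longrightarrow> char_pairing G (\<lambda>g. \<Sum>x\<in>X. f x g) h = (\<Sum>x\<in>X. char_pairing G (f x) h)"
proof (induction X rule: finite_induct)
  case empty
  then show ?case by (simp add: char_pairing_def)
qed (simp add: char_pairing_add)

section \<open>Sums over the group and averaging\<close>

context group
begin

lemma cancel_inv:
  assumes "x \<in> carrier G" "y \<in> carrier G"
  shows "x \<otimes> (inv x \<otimes> y) = y" "inv x \<otimes> (x \<otimes> y) = y"
  using assms by (simp_all add: m_assoc[symmetric])

lemma sum_left_translate:
  assumes "h \<in> carrier G"
  shows "(\<Sum>g\<in>carrier G. f (h \<otimes> g)) = (\<Sum>g\<in>carrier G. f g)"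
  by (rule sum.reindex_bij_witness[of _ "\<lambda>g. inv h \<otimes> g" "\<lambda>g. h \<otimes> g"])
    (use assms in \<open>auto simp: m_assoc[symmetric]\<close>)

lemma sum_conjugate:
  assumes "h \<in> carrier G"
  shows "(\<Sum>g\<in>carrier G. f (h \<otimes> g \<otimes> inv h)) = (\<Sum>g\<in>carrier G. f g)"
  by (rule sum.reindex_bij_witness[of _ "\<lambda>g. inv h \<otimes> g \<otimes> h" "\<lambda>g. h \<otimes> g \<otimes> inv h"])
    (use assms in \<open>auto simp: m_assoc cancel_inv\<close>)

lemma char_pairing_commute: "char_pairing G f h = char_pairing G h f"
proof -
  have "(\<Sum>g\<in>carrier G. f g * h (inv g)) = (\<Sum>g\<in>carrier G. h g * f (inv g))"
    by (rule sum.reindex_bij_witness[of _ "\<lambda>g. inv g" "\<lambda>g. inv g"]) auto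
  then show ?thesis unfolding char_pairing_def by simp
qed

text \<open>\<open>T\<close> is the sum over \<open>g\<close> of \<open>S g * E * R (inv g)\<close>,
  where \<open>E\<close> is the matrix unit with its 1 at position \<open>(j, k)\<close>. Replacing
  \<open>g\<close> by \<open>h \<otimes> g\<close> carries \<open>R h\<close> on the right over to
  \<open>S h\<close> on the left.\<close>

lemma averaged_intertwiner:
  assumes repR: "representation G n R" and repS: "representation G m S"
    and j: "j < m" and k: "k < n" and h: "h \<in> carrier G"
  defines "T \<equiv> mat m n (\<lambda>(i, l). \<Sum>g\<in>carrier G. S g $$ (i, j) * R (inv g) $$ (k, l))"
  shows "T * R h = S h * T"
proof (rule eq_matI)
  note R = representationD[OF repR] and S = representationD[OF repS]
  note Rh = R(1)[OF h] and Sh = S(1)[OF h]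
  have T: "T \<in> carrier_mat m n" unfolding T_def by simp
  fix i l assume "i < dim_row (S h * T)" "l < dim_col (S h * T)"
  then have i: "i < m" and l: "l < n" using Sh T by auto
  have "(T * R h) $$ (i, l) = (\<Sum>p<n. \<Sum>g\<in>carrier G. S g $$ (i, j) * (R (inv g) $$ (k, p) * R h $$ (p, l)))"
    by (subst mult_mat_entry[OF T Rh i l])
      (auto simp: T_def i sum_distrib_right mult.assoc intro!: sum.cong)
  also have "\<dots> = (\<Sum>g\<in>carrier G. S g $$ (i, j) * (\<Sum>p<n. R (inv g) $$ (k, p) * R h $$ (p, l)))"
    by (subst sum.swap) (simp add: sum_distrib_left)
  also have "\<dots> = (\<Sum>g\<in>carrier G. S g $$ (i, j) * R (inv g \<otimes> h) $$ (k, l))"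
    by (intro sum.cong refl arg_cong2[where f = "(*)"])
      (simp_all add: R(2) h mult_mat_entry[OF R(1) Rh k l])
  also have "\<dots> = (\<Sum>g\<in>carrier G. S (h \<otimes> g) $$ (i, j) * R (inv (h \<otimes> g) \<otimes> h) $$ (k, l))"
    by (rule sum_left_translate[OF h, symmetric])
  also have "\<dots> = (\<Sum>g\<in>carrier G. (\<Sum>p<m. S h $$ (i, p) * S g $$ (p, j)) * R (inv g) $$ (k, l))"
  proof (intro sum.cong refl arg_cong2[where f = "(*)"])
    fix g assume g: "g \<in> carrier G"
    show "S (h \<otimes> g) $$ (i, j) = (\<Sum>p<m. S h $$ (i, p) * S g $$ (p, j))"
      by (simp only: S(2)[OF h g] mult_mat_entry[OF Sh S(1)[OF g] i j])
    show "R (inv (h \<otimes> g) \<otimes> h) $$ (k, l) = R (inv g) $$ (k, l)"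
      using g h by (simp add: inv_mult_group m_assoc)
  qed
  also have "\<dots> = (\<Sum>p<m. \<Sum>g\<in>carrier G. S h $$ (i, p) * (S g $$ (p, j) * R (inv g) $$ (k, l)))"
    by (subst sum.swap) (simp add: sum_distrib_right mult.assoc)
  also have "\<dots> = (S h * T) $$ (i, l)"
    by (subst mult_mat_entry[OF Sh T i l])
      (auto simp: T_def l sum_distrib_left intro!: sum.cong)
  finally show "(T * R h) $$ (i, l) = (S h * T) $$ (i, l)" .
qed (use representationD(1)[OF repR h] representationD(1)[OF repS h] in \<open>auto simp: T_def\<close>)

section \<open>Values of irreducible characters\<close>

lemma IrrE:
  assumes "\<chi> \<in> Irr G"
  obtains n R where "irreducible_representation G n R" "\<chi> = rep_character G R"
    "\<And>g. g \<in> carrier G \<Longrightarrow> R g \<in> carrier_mat n n"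
    "\<And>g. g \<in> carrier G \<Longrightarrow> \<chi> g = (\<Sum>i<n. R g $$ (i, i))"
proof -
  obtain n R where irr: "irreducible_representation G n R" and \<chi>: "\<chi> = rep_character G R"
    using assms unfolding Irr_def by blast
  note R = representationD(1)[OF irreducible_representationD(1)[OF irr]]
  show ?thesis
    by (rule that[OF irr \<chi> R]) (use R in \<open>auto simp: \<chi> rep_character_def mat_trace_def\<close>)
qed

lemma Irr_one:
  assumes "\<chi> \<in> Irr G"
  obtains n where "n > 0" "\<chi> \<one> = of_nat n"
proof -
  obtain n R where irr: "irreducible_representation G n R" and \<chi>: "\<chi> = rep_character G R"
    by (rule IrrE[OF assms]) (rule that)
  have "\<chi> \<one> = of_nat n"
    using representationD(3)[OF irreducible_representationD(1)[OF irr]] mat_trace_one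
    unfolding \<chi> rep_character_def by simp
  then show ?thesis using that irreducible_representationD(2)[OF irr] by blast
qed

lemma char_degree_pos: "\<chi> \<in> Irr G \<Longrightarrow> char_degree G \<chi> > 0"
  by (rule Irr_one) (auto simp: char_degree_def)

lemma Irr_conjugate:
  assumes "\<chi> \<in> Irr G" and h: "h \<in> carrier G" and g: "g \<in> carrier G"
  shows "\<chi> (h \<otimes> g \<otimes> inv h) = \<chi> g"
proof -
  obtain n R where irr: "irreducible_representation G n R" and \<chi>: "\<chi> = rep_character G R"
    by (rule IrrE[OF assms(1)]) (rule that)
  note R = representationD[OF irreducible_representationD(1)[OF irr]]
  have "R (h \<otimes> g \<otimes> inv h) = R (h \<otimes> g) * R (inv h)"
    using g h by (intro R(2)) auto
  then have "mat_trace (R (h \<otimes> g \<otimes> inv h)) = mat_trace (R (inv h) * R (h \<otimes> g))"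
    using mat_trace_mult_comm[OF R(1) R(1), of "h \<otimes> g" "inv h"] g h by (metis inv_closed m_closed)
  also have "R (inv h) * R (h \<otimes> g) = R (inv h \<otimes> (h \<otimes> g))"
    using g h by (intro R(2)[symmetric]) auto
  also have "inv h \<otimes> (h \<otimes> g) = g"
    using g h by (simp add: cancel_inv)
  finally show ?thesis unfolding \<chi> rep_character_def using g h by simp
qed

end

section \<open>Orthogonality relations and convolution with class functions\<close>

context finite_group
begin

lemma carrier_neq_empty [simp]: "carrier G \<noteq> {}"
  using one_closed by blast

text \<open>Expanding both traces, each sum over \<open>g\<close> of a product of diagonal entries
  is an entry of an averaged matrix unit. By Schur's lemma this intertwiner is zero for distinct
  characters and a scalar for equal ones.\<close>

lemma Irr_orthonormal:
  assumes "\<chi> \<in> Irr G" "\<psi> \<in> Irr G"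
  shows "char_pairing G \<chi> \<psi> = (if \<chi> = \<psi> then 1 else 0)"
proof -
  obtain m S where irrS: "irreducible_representation G m S" and \<chi>: "\<chi> = rep_character G S"
    and S: "\<And>g. g \<in> carrier G \<Longrightarrow> S g \<in> carrier_mat m m"
    and trS: "\<And>g. g \<in> carrier G \<Longrightarrow> \<chi> g = (\<Sum>i<m. S g $$ (i, i))"
    by (rule IrrE[OF assms(1)]) (rule that)
  note repS = irreducible_representationD(1)[OF irrS]
  define N where "N = (of_nat (card (carrier G)) :: complex)"
  have N: "N \<noteq> 0" unfolding N_def by simp
  show ?thesis
  proof (cases "\<chi> = \<psi>")
    case False
    obtain n R where irrR: "irreducible_representation G n R" and \<psi>: "\<psi> = rep_character G R"
      and R: "\<And>g. g \<in> carrier G \<Longrightarrow> R g \<in> carrier_mat n n"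
      and trR: "\<And>g. g \<in> carrier G \<Longrightarrow> \<psi> g = (\<Sum>i<n. R g $$ (i, i))"
      by (rule IrrE[OF assms(2)]) (rule that)
    note repR = irreducible_representationD(1)[OF irrR]
    have z: "(\<Sum>g\<in>carrier G. S g $$ (i, i) * R (inv g) $$ (k, k)) = 0" if i: "i < m" and k: "k < n" for i k
    proof -
      have "mat m n (\<lambda>(i', l). \<Sum>g\<in>carrier G. S g $$ (i', i) * R (inv g) $$ (k, l)) = 0\<^sub>m m n"
        using averaged_intertwiner[OF repR repS i k] False \<chi> \<psi>
        by (intro schur_intertwiner_zero[OF irrR irrS]) auto
      from arg_cong[OF this, of "\<lambda>A. A $$ (i, k)"] show ?thesis using i k by simp
    qed
    have "(\<Sum>g\<in>carrier G. \<chi> g * \<psi> (inv g))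
        = (\<Sum>g\<in>carrier G. \<Sum>i<m. \<Sum>k<n. S g $$ (i, i) * R (inv g) $$ (k, k))"
      using trS trR by (intro sum.cong) (auto simp: sum_product)
    also have "\<dots> = (\<Sum>i<m. \<Sum>g\<in>carrier G. \<Sum>k<n. S g $$ (i, i) * R (inv g) $$ (k, k))"
      by (rule sum.swap)
    also have "\<dots> = (\<Sum>i<m. \<Sum>k<n. \<Sum>g\<in>carrier G. S g $$ (i, i) * R (inv g) $$ (k, k))"
      by (intro sum.cong refl) (rule sum.swap)
    also have "\<dots> = 0" using z by simp
    finally show ?thesis unfolding char_pairing_def using False by simp
  next
    case True
    have m: "m > 0" using irreducible_representationD(2)[OF irrS] .
    have diag: "(\<Sum>g\<in>carrier G. S g $$ (i, i) * S (inv g) $$ (k, k)) = (if i = k then N / of_nat m else 0)"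
      if i: "i < m" and k: "k < m" for i k
    proof -
      define T where "T = mat m m (\<lambda>(i', l). \<Sum>g\<in>carrier G. S g $$ (i', i) * S (inv g) $$ (k, l))"
      obtain c where c: "T = c \<cdot>\<^sub>m 1\<^sub>m m"
        using averaged_intertwiner[OF repS repS i k] schur_scalar[OF irrS, of T] unfolding T_def
        by auto
      \<comment> \<open>The scalar is found from the trace of \<open>T\<close>: the sum over
        \<open>p\<close> collapses to an entry of \<open>S (inv g) * S g\<close>, the identity
        matrix.\<close>
      have "c * of_nat m = (\<Sum>p<m. T $$ (p, p))" unfolding c by simp
      also have "\<dots> = (\<Sum>g\<in>carrier G. \<Sum>p<m. S (inv g) $$ (k, p) * S g $$ (p, i))"
        unfolding T_def by (subst sum.swap) (simp add: mult.commute)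
      also have "\<dots> = (\<Sum>g\<in>carrier G. if i = k then 1 else 0)"
      proof (intro sum.cong refl)
        fix g assume g: "g \<in> carrier G"
        have "(\<Sum>p<m. S (inv g) $$ (k, p) * S g $$ (p, i)) = (S (inv g) * S g) $$ (k, i)"
          using g by (intro mult_mat_entry[OF S S k i, symmetric]) auto
        also have "S (inv g) * S g = 1\<^sub>m m"
          using representationD(2)[OF repS, of "inv g" g] representationD(3)[OF repS] g by simp
        finally show "(\<Sum>p<m. S (inv g) $$ (k, p) * S g $$ (p, i)) = (if i = k then 1 else 0)"
          using i k by auto
      qed
      finally have "c = (if i = k then N / of_nat m else 0)"
        using m unfolding N_def by (auto simp: field_simps)
      moreover have "(\<Sum>g\<in>carrier G. S g $$ (i, i) * S (inv g) $$ (k, k)) = T $$ (i, k)"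
        unfolding T_def using i k by simp
      ultimately show ?thesis unfolding c using i k by simp
    qed
    have "(\<Sum>g\<in>carrier G. \<chi> g * \<psi> (inv g))
        = (\<Sum>g\<in>carrier G. \<Sum>i<m. \<Sum>k<m. S g $$ (i, i) * S (inv g) $$ (k, k))"
      using trS True by (intro sum.cong) (auto simp: sum_product)
    also have "\<dots> = (\<Sum>i<m. \<Sum>g\<in>carrier G. \<Sum>k<m. S g $$ (i, i) * S (inv g) $$ (k, k))"
      by (rule sum.swap)
    also have "\<dots> = (\<Sum>i<m. \<Sum>k<m. \<Sum>g\<in>carrier G. S g $$ (i, i) * S (inv g) $$ (k, k))"
      by (intro sum.cong refl) (rule sum.swap)
    also have "\<dots> = (\<Sum>i<m. \<Sum>k<m. if i = k then N / of_nat m else 0)"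
      by (intro sum.cong refl) (simp add: diag)
    also have "\<dots> = N" using m by simp
    finally show ?thesis unfolding char_pairing_def N_def[symmetric] using True N by simp
  qed
qed

text \<open>The operator \<open>\<Sum>h. f h R(h\<^sup>-\<^sup>1)\<close> is central, hence a scalar by Schur's lemma.\<close>

lemma class_function_convolution:
  assumes cl: "\<And>g h. g \<in> carrier G \<Longrightarrow> h \<in> carrier G \<Longrightarrow> f (h \<otimes> g \<otimes> inv h) = f g"
    and "\<chi> \<in> Irr G"
  shows "\<exists>c. \<forall>g\<in>carrier G. (\<Sum>h\<in>carrier G. f h * \<chi> (inv h \<otimes> g)) = c * \<chi> g"
proof -
  obtain n R where irr: "irreducible_representation G n R" and \<chi>: "\<chi> = rep_character G R"
    and R1: "\<And>g. g \<in> carrier G \<Longrightarrow> R g \<in> carrier_mat n n"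
    and tr: "\<And>g. g \<in> carrier G \<Longrightarrow> \<chi> g = (\<Sum>i<n. R g $$ (i, i))"
    by (rule IrrE[OF assms(2)]) (rule that)
  note R = representationD[OF irreducible_representationD(1)[OF irr]]
  define M where "M = mat n n (\<lambda>(i, j). \<Sum>h\<in>carrier G. f h * R (inv h) $$ (i, j))"
  have M: "M \<in> carrier_mat n n" unfolding M_def by simp
  have MR: "(M * R g) $$ (i, l) = (\<Sum>h\<in>carrier G. f h * R (inv h \<otimes> g) $$ (i, l))"
    if g: "g \<in> carrier G" and i: "i < n" and l: "l < n" for g i l
  proof -
    have "(M * R g) $$ (i, l) = (\<Sum>p<n. \<Sum>h\<in>carrier G. f h * (R (inv h) $$ (i, p) * R g $$ (p, l)))"
      by (subst mult_mat_entry[OF M R(1)[OF g] i l])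
        (auto simp: M_def i sum_distrib_right mult.assoc intro!: sum.cong)
    also have "\<dots> = (\<Sum>h\<in>carrier G. f h * (\<Sum>p<n. R (inv h) $$ (i, p) * R g $$ (p, l)))"
      by (subst sum.swap) (simp add: sum_distrib_left)
    also have "\<dots> = (\<Sum>h\<in>carrier G. f h * R (inv h \<otimes> g) $$ (i, l))"
      by (intro sum.cong refl arg_cong2[where f = "(*)"])
        (simp_all add: R(2) g mult_mat_entry[OF R(1) R(1)[OF g] i l])
    finally show ?thesis .
  qed
  have "M * R g = R g * M" if g: "g \<in> carrier G" for g
  proof (rule eq_matI)
    fix i l assume "i < dim_row (R g * M)" "l < dim_col (R g * M)"
    then have i: "i < n" and l: "l < n" using M R(1)[OF g] by auto
    have "(R g * M) $$ (i, l) = (\<Sum>p<n. \<Sum>h\<in>carrier G. f h * (R g $$ (i, p) * R (inv h) $$ (p, l)))"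
      by (subst mult_mat_entry[OF R(1)[OF g] M i l])
        (auto simp: M_def l sum_distrib_left mult.left_commute intro!: sum.cong)
    also have "\<dots> = (\<Sum>h\<in>carrier G. f h * (\<Sum>p<n. R g $$ (i, p) * R (inv h) $$ (p, l)))"
      by (subst sum.swap) (simp add: sum_distrib_left)
    \<comment> \<open>Prepares the substitution of \<open>g \<otimes> h \<otimes> inv g\<close> for
      \<open>h\<close>, under which \<open>f\<close> is invariant and
      \<open>g \<otimes> inv h\<close> takes the form found in \<open>M * R g\<close>.\<close>
    also have "\<dots> = (\<Sum>h\<in>carrier G. f (g \<otimes> h \<otimes> inv g) * R (inv (g \<otimes> h \<otimes> inv g) \<otimes> g) $$ (i, l))"
    proof (intro sum.cong refl arg_cong2[where f = "(*)"])
      fix h assume h: "h \<in> carrier G"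
      show "f h = f (g \<otimes> h \<otimes> inv g)" using cl[OF h g] by simp
      have "(\<Sum>p<n. R g $$ (i, p) * R (inv h) $$ (p, l)) = R (g \<otimes> inv h) $$ (i, l)"
        using R(1)[of "inv h"] h g by (simp add: R(2) mult_mat_entry[OF R(1)[OF g] _ i l])
      also have "g \<otimes> inv h = inv (g \<otimes> h \<otimes> inv g) \<otimes> g"
        using g h by (simp add: inv_mult_group m_assoc)
      finally show "(\<Sum>p<n. R g $$ (i, p) * R (inv h) $$ (p, l))
          = R (inv (g \<otimes> h \<otimes> inv g) \<otimes> g) $$ (i, l)" .
    qed
    also have "\<dots> = (\<Sum>h\<in>carrier G. f h * R (inv h \<otimes> g) $$ (i, l))"
      by (rule sum_conjugate[OF g])
    finally show "(M * R g) $$ (i, l) = (R g * M) $$ (i, l)" using MR[OF g i l] by simp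
  qed (use M R(1)[OF g] in auto)
  then obtain c where c: "M = c \<cdot>\<^sub>m 1\<^sub>m n" using schur_scalar[OF irr M] by blast
  have "(\<Sum>h\<in>carrier G. f h * \<chi> (inv h \<otimes> g)) = c * \<chi> g" if g: "g \<in> carrier G" for g
  proof -
    have "(\<Sum>h\<in>carrier G. f h * \<chi> (inv h \<otimes> g))
        = (\<Sum>h\<in>carrier G. \<Sum>i<n. f h * R (inv h \<otimes> g) $$ (i, i))"
      using g by (intro sum.cong) (auto simp: tr sum_distrib_left)
    also have "\<dots> = (\<Sum>i<n. (M * R g) $$ (i, i))"
      by (subst sum.swap) (simp add: MR[OF g])
    also have "M * R g = c \<cdot>\<^sub>m R g"
      unfolding c using mult_smult_assoc_mat[OF one_carrier_mat R(1)[OF g]] R(1)[OF g] by simp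
    finally show ?thesis using R(1)[OF g] g by (simp add: tr sum_distrib_left)
  qed
  then show ?thesis by blast
qed

section \<open>The regular representation\<close>

lemma regular_character:
  obtains cs where "set cs \<subseteq> Irr G"
    "\<And>g. g \<in> carrier G \<Longrightarrow> (\<Sum>\<chi>\<leftarrow>cs. \<chi> g) = (if g = \<one> then of_nat (card (carrier G)) else 0)"
proof -
  define n where "n = card (carrier G)"
  obtain e where e: "bij_betw e {..<n} (carrier G)"
    using ex_bij_betw_nat_finite[OF fin] unfolding n_def atLeast0LessThan by blast
  have ec: "e i \<in> carrier G" if "i < n" for i using e that unfolding bij_betw_def by blast
  have ei: "e i = e j \<longleftrightarrow> i = j" if "i < n" "j < n" for i j
    using e that unfolding bij_betw_def inj_on_def by auto
  \<comment> \<open>Permutation matrices of left translation, with the group elements numbered by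
    \<open>e\<close>.\<close>
  define R where "R = (\<lambda>g. mat n n (\<lambda>(i, j). if g \<otimes> e j = e i then 1 else 0 :: complex))"
  have Rc: "R g \<in> carrier_mat n n" for g unfolding R_def by simp
  have rep: "representation G n R"
  proof (rule representationI)
    fix g h assume g: "g \<in> carrier G" and h: "h \<in> carrier G"
    show "R (g \<otimes> h) = R g * R h"
    proof (rule eq_matI)
      fix i j assume "i < dim_row (R g * R h)" "j < dim_col (R g * R h)"
      then have i: "i < n" and j: "j < n" using Rc[of g] Rc[of h] by auto
      \<comment> \<open>\<open>q\<close> numbers the element to which \<open>h\<close> moves
        \<open>e j\<close>; only this index survives in the matrix product.\<close>
      obtain q where q: "q < n" "e q = h \<otimes> e j"
      proof -
        have "h \<otimes> e j \<in> e ` {..<n}" using e h ec[OF j] unfolding bij_betw_def by simp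
        then show ?thesis using that by force
      qed
      have "(R g * R h) $$ (i, j) = (\<Sum>p<n. if p = q then (if g \<otimes> e q = e i then 1 else 0) else 0)"
        unfolding mult_mat_entry[OF Rc Rc i j]
        by (intro sum.cong refl) (auto simp: R_def i j q(2)[symmetric] ei q(1))
      also have "\<dots> = (if g \<otimes> e q = e i then 1 else 0)" using q by simp
      also have "\<dots> = R (g \<otimes> h) $$ (i, j)" unfolding R_def using i j q g h ec by (simp add: m_assoc)
      finally show "R (g \<otimes> h) $$ (i, j) = (R g * R h) $$ (i, j)" by simp
    qed (simp_all add: R_def)
  next
    show "R \<one> = 1\<^sub>m n" by (rule eq_matI) (auto simp: R_def ec ei)
  qed (rule Rc)
  \<comment> \<open>The trace of a permutation matrix counts fixed points, and a translation by a
    nontrivial element has none.\<close>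
  have "mat_trace (R g) = (if g = \<one> then of_nat n else 0)" if g: "g \<in> carrier G" for g
  proof -
    have "mat_trace (R g) = (\<Sum>i<n. if g \<otimes> e i = e i then 1 else 0)"
      unfolding mat_trace_def R_def by simp
    also have "\<dots> = (\<Sum>i<n. if g = \<one> then 1 else 0)"
      using g ec by (intro sum.cong refl) (simp add: r_cancel_one)
    finally show ?thesis by simp
  qed
  then show ?thesis using that rep_character_sum_irreducible[OF rep] unfolding n_def by metis
qed

lemma char_pairing_sum_list:
  assumes "set cs \<subseteq> Irr G" "\<psi> \<in> Irr G"
  shows "char_pairing G (\<lambda>g. \<Sum>\<chi>\<leftarrow>cs. \<chi> g) \<psi> = of_nat (count_list cs \<psi>)"
  using assms
proof (induction cs)
  case Nil
  then show ?case by (simp add: char_pairing_def)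
next
  case (Cons \<chi> cs)
  then show ?case by (simp add: char_pairing_add Irr_orthonormal)
qed

lemma regular_pairing:
  "char_pairing G (\<lambda>g. if g = \<one> then of_nat (card (carrier G)) else 0) \<psi> = \<psi> \<one>"
proof -
  have "(\<Sum>g\<in>carrier G. (if g = \<one> then of_nat (card (carrier G)) else 0) * \<psi> (inv g))
      = (\<Sum>g\<in>carrier G. if g = \<one> then of_nat (card (carrier G)) * \<psi> \<one> else 0)"
    by (intro sum.cong) auto
  then show ?thesis unfolding char_pairing_def by simp
qed

text \<open>Orthonormality makes the pairing with \<open>\<psi>\<close> count its occurrences, while
  pairing with the regular character evaluates at the identity. Hence each irreducible character
  occurs as often as its degree.\<close>

lemma regular_count:
  assumes "set cs \<subseteq> Irr G"
    and "\<And>g. g \<in> carrier G \<Longrightarrow> (\<Sum>\<chi>\<leftarrow>cs. \<chi> g) = (if g = \<one> then of_nat (card (carrier G)) else 0)"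
    and "\<psi> \<in> Irr G"
  shows "of_nat (count_list cs \<psi>) = \<psi> \<one>"
proof -
  have "of_nat (count_list cs \<psi>) = char_pairing G (\<lambda>g. \<Sum>\<chi>\<leftarrow>cs. \<chi> g) \<psi>"
    by (rule char_pairing_sum_list[OF assms(1,3), symmetric])
  also have "\<dots> = char_pairing G (\<lambda>g. if g = \<one> then of_nat (card (carrier G)) else 0) \<psi>"
    by (rule char_pairing_cong) (rule assms(2))
  finally show ?thesis unfolding regular_pairing .
qed

text \<open>Degrees are positive, so every irreducible character occurs in the finite list of
  constituents of the regular character.\<close>

lemma finite_Irr: "finite (Irr G)"
proof -
  obtain cs where cs: "set cs \<subseteq> Irr G"
    "\<And>g. g \<in> carrier G \<Longrightarrow> (\<Sum>\<chi>\<leftarrow>cs. \<chi> g) = (if g = \<one> then of_nat (card (carrier G)) else 0)"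
    using regular_character by blast
  have "\<psi> \<in> set cs" if \<psi>: "\<psi> \<in> Irr G" for \<psi>
  proof -
    obtain n where "n > 0" "\<psi> \<one> = of_nat n" using Irr_one[OF \<psi>] .
    then have "count_list cs \<psi> > 0" using regular_count[OF cs \<psi>] by simp
    then show ?thesis using count_notin by fastforce
  qed
  then show ?thesis using finite_subset[of "Irr G" "set cs"] by blast
qed

lemma sum_list_Irr:
  assumes "set cs \<subseteq> Irr G"
  shows "(\<Sum>\<chi>\<leftarrow>cs. \<chi> g) = (\<Sum>\<chi>\<in>Irr G. of_nat (count_list cs \<chi>) * \<chi> g)"
  using assms
proof (induction cs)
  case (Cons \<psi> cs)
  have "(\<Sum>\<chi>\<in>Irr G. of_nat (count_list (\<psi> # cs) \<chi>) * \<chi> g)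
      = (\<Sum>\<chi>\<in>Irr G. (if \<chi> = \<psi> then \<psi> g else 0) + of_nat (count_list cs \<chi>) * \<chi> g)"
    by (intro sum.cong) (auto simp: algebra_simps)
  then show ?case using Cons finite_Irr by (simp add: sum.distrib)
qed simp

text \<open>Column orthogonality against the identity class. It yields the sum of squares of the
  degrees at \<open>g = \<one>\<close>, and in general it expands the indicator of the
  identity.\<close>

lemma regular_character_Irr:
  assumes "g \<in> carrier G"
  shows "(\<Sum>\<chi>\<in>Irr G. \<chi> \<one> * \<chi> g) = (if g = \<one> then of_nat (card (carrier G)) else 0)"
proof -
  obtain cs where cs: "set cs \<subseteq> Irr G"
    "\<And>g. g \<in> carrier G \<Longrightarrow> (\<Sum>\<chi>\<leftarrow>cs. \<chi> g) = (if g = \<one> then of_nat (card (carrier G)) else 0)"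
    using regular_character by blast
  have "(\<Sum>\<chi>\<in>Irr G. \<chi> \<one> * \<chi> g) = (\<Sum>\<chi>\<in>Irr G. of_nat (count_list cs \<chi>) * \<chi> g)"
    using regular_count[OF cs] by simp
  then show ?thesis using sum_list_Irr[OF cs(1)] cs(2)[OF assms] by simp
qed

section \<open>Coefficients of class functions and uniqueness of multiplicities\<close>

lemma char_pairing_Irr_sum:
  assumes "\<And>g. g \<in> carrier G \<Longrightarrow> f g = (\<Sum>\<chi>\<in>Irr G. a \<chi> * \<chi> g)" and "\<psi> \<in> Irr G"
  shows "char_pairing G f \<psi> = a \<psi>"
proof -
  have "char_pairing G f \<psi> = (\<Sum>\<chi>\<in>Irr G. a \<chi> * char_pairing G \<chi> \<psi>)"
    using char_pairing_cong[OF assms(1)] by (simp add: char_pairing_sum[OF finite_Irr] char_pairing_smult)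
  also have "\<dots> = (\<Sum>\<chi>\<in>Irr G. if \<chi> = \<psi> then a \<psi> else 0)"
    using assms(2) by (intro sum.cong) (auto simp: Irr_orthonormal)
  finally show ?thesis using assms(2) finite_Irr by simp
qed

text \<open>A class function is its own convolution with the indicator of the identity, which is
  the regular character up to a factor, so it suffices to convolve with irreducible characters.\<close>

lemma class_function_expansion:
  assumes cl: "\<And>g h. g \<in> carrier G \<Longrightarrow> h \<in> carrier G \<Longrightarrow> f (h \<otimes> g \<otimes> inv h) = f g"
    and g: "g \<in> carrier G"
  shows "f g = (\<Sum>\<chi>\<in>Irr G. char_pairing G f \<chi> * \<chi> g)"
proof -
  define N where "N = (of_nat (card (carrier G)) :: complex)"
  have N: "N \<noteq> 0" unfolding N_def by simp
  have "\<forall>\<chi>\<in>Irr G. \<exists>c. \<forall>g\<in>carrier G. (\<Sum>h\<in>carrier G. f h * \<chi> (inv h \<otimes> g)) = c * \<chi> g"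
    using class_function_convolution[OF cl] by blast
  from bchoice[OF this] obtain c where c: "\<And>\<chi> g. \<chi> \<in> Irr G \<Longrightarrow> g \<in> carrier G \<Longrightarrow>
      (\<Sum>h\<in>carrier G. f h * \<chi> (inv h \<otimes> g)) = c \<chi> * \<chi> g"
    by blast
  have f: "f g = (\<Sum>\<chi>\<in>Irr G. (\<chi> \<one> * c \<chi> / N) * \<chi> g)" if g: "g \<in> carrier G" for g
  proof -
    have "N * f g = (\<Sum>h\<in>carrier G. if h = g then f g * N else 0)" using g by simp
    also have "\<dots> = (\<Sum>h\<in>carrier G. f h * (\<Sum>\<chi>\<in>Irr G. \<chi> \<one> * \<chi> (inv h \<otimes> g)))"
    proof (intro sum.cong refl)
      fix h assume h: "h \<in> carrier G"
      have "inv h \<otimes> g = \<one> \<longleftrightarrow> h = g" using g h by (metis inv_closed inv_equality inv_inv l_inv)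
      then show "(if h = g then f g * N else 0) = f h * (\<Sum>\<chi>\<in>Irr G. \<chi> \<one> * \<chi> (inv h \<otimes> g))"
        using g h by (simp add: regular_character_Irr N_def)
    qed
    also have "\<dots> = (\<Sum>\<chi>\<in>Irr G. \<chi> \<one> * (\<Sum>h\<in>carrier G. f h * \<chi> (inv h \<otimes> g)))"
      unfolding sum_distrib_left by (subst sum.swap) (simp add: mult.left_commute)
    also have "\<dots> = (\<Sum>\<chi>\<in>Irr G. \<chi> \<one> * (c \<chi> * \<chi> g))"
      using c g by (intro sum.cong) auto
    also have "\<dots> = N * (\<Sum>\<chi>\<in>Irr G. (\<chi> \<one> * c \<chi> / N) * \<chi> g)"
      unfolding sum_distrib_left using N by (intro sum.cong) auto
    finally show ?thesis using N by simp
  qed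
  \<comment> \<open>The scalars \<open>c\<close> need not be computed: orthonormality determines the
    coefficients of any such expansion as pairings.\<close>
  have "char_pairing G f \<chi> = \<chi> \<one> * c \<chi> / N" if "\<chi> \<in> Irr G" for \<chi>
    by (rule char_pairing_Irr_sum[where a = "\<lambda>\<chi>. \<chi> \<one> * c \<chi> / N"]) (use f that in auto)
  then show ?thesis using f[OF g] by simp
qed

text \<open>Resolves the definite description: the expansion provides a family, orthonormality
  determines its values on \<open>Irr G\<close>, and the value 0 elsewhere makes it unique as a
  function.\<close>

lemma irr_multiplicities_eq_pairing:
  assumes m: "\<And>\<chi>. \<chi> \<in> Irr G \<Longrightarrow> char_pairing G f \<chi> = of_nat (m \<chi>)"
    and f: "\<And>g. g \<in> carrier G \<Longrightarrow> f g = (\<Sum>\<chi>\<in>Irr G. char_pairing G f \<chi> * \<chi> g)"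
    and \<chi>: "\<chi> \<in> Irr G"
  shows "irr_multiplicities G f \<chi> = m \<chi>"
proof -
  have "irr_multiplicities G f = (\<lambda>\<chi>. if \<chi> \<in> Irr G then m \<chi> else 0)"
    unfolding irr_multiplicities_def
  proof (rule the_equality, intro conjI allI impI ballI)
    fix m' assume m': "(\<forall>\<chi>. \<chi> \<notin> Irr G \<longrightarrow> m' \<chi> = 0) \<and>
      (\<forall>g\<in>carrier G. f g = (\<Sum>\<chi>\<in>Irr G. of_nat (m' \<chi>) * \<chi> g))"
    have "m' \<chi> = m \<chi>" if "\<chi> \<in> Irr G" for \<chi>
    proof -
      have "char_pairing G f \<chi> = of_nat (m' \<chi>)"
        by (rule char_pairing_Irr_sum[where a = "\<lambda>\<chi>. of_nat (m' \<chi>)"]) (use m' that in auto)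
      then show ?thesis using m[OF that] by simp
    qed
    then show "m' = (\<lambda>\<chi>. if \<chi> \<in> Irr G then m \<chi> else 0)" using m' by auto
  qed (use m f in auto)
  then show ?thesis using \<chi> by simp
qed

section \<open>Squares of the degrees\<close>

lemma card_eq_sum_char_degree:
  "real (card (carrier G)) = (\<Sum>\<chi>\<in>Irr G. (char_degree G \<chi>)\<^sup>2)"
proof -
  have "complex_of_real (\<Sum>\<chi>\<in>Irr G. (char_degree G \<chi>)\<^sup>2) = (\<Sum>\<chi>\<in>Irr G. \<chi> \<one> * \<chi> \<one>)"
    unfolding of_real_sum
  proof (intro sum.cong refl)
    fix \<chi> assume "\<chi> \<in> Irr G"
    then obtain n where "\<chi> \<one> = of_nat n" using Irr_one by metis
    then show "complex_of_real ((char_degree G \<chi>)\<^sup>2) = \<chi> \<one> * \<chi> \<one>"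
      by (simp add: char_degree_def power2_eq_square)
  qed
  also have "\<dots> = complex_of_real (real (card (carrier G)))"
    using regular_character_Irr[of \<one>] by simp
  finally show ?thesis using of_real_eq_iff by metis
qed

lemma char_degree_le_sqrt:
  assumes "\<chi> \<in> Irr G"
  shows "char_degree G \<chi> \<le> sqrt (real (card (carrier G)))"
  unfolding card_eq_sum_char_degree
  by (rule real_le_rsqrt, rule member_le_sum[of \<chi> "Irr G" "\<lambda>\<chi>. (char_degree G \<chi>)\<^sup>2"])
    (use assms finite_Irr in auto)

end

section \<open>Restriction and induction\<close>

locale finite_group_subgroup = finite_group G + subgroup H G for G (structure) and H
begin

abbreviation "K \<equiv> G\<lparr>carrier := H\<rparr>"

lemma finite_H: "finite H"
  using fin subset finite_subset by blast

sublocale K: finite_group K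
  by (rule finite_group.intro)
    (use subgroup_is_group[OF is_group] finite_H in \<open>auto intro: finite_group_axioms.intro\<close>)

lemma inv_K: "h \<in> H \<Longrightarrow> inv\<^bsub>K\<^esub> h = inv h"
  using m_inv_consistent[OF subgroup_axioms] by simp

section \<open>Restriction of characters and Frobenius reciprocity\<close>

lemma restrict_representation: "representation G n R \<Longrightarrow> representation K n R"
  using representationD[of n R] subset by (intro K.representationI) auto

lemma restrict_Irr:
  assumes "\<rho> \<in> Irr G"
  obtains cs where "set cs \<subseteq> Irr K" "\<And>h. h \<in> H \<Longrightarrow> \<rho> h = (\<Sum>\<pi>\<leftarrow>cs. \<pi> h)"
proof -
  obtain n R where irr: "irreducible_representation G n R" and \<rho>: "\<rho> = rep_character G R"
    using IrrE[OF assms] by metis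
  have "representation K n R"
    using restrict_representation irreducible_representationD(1)[OF irr] .
  from K.rep_character_sum_irreducible[OF this] show ?thesis
    using that subset unfolding \<rho> rep_character_def by (auto simp: subset_iff)
qed

text \<open>Conjugating the summation variable by \<open>x\<close> and using that
  \<open>\<rho>\<close> is a class function makes the inner sum independent of \<open>x\<close>. The
  factor \<open>|G|\<close> from the sum over \<open>x\<close> cancels the one in the pairing, and a
  sum over \<open>H\<close> divided by \<open>|H|\<close> remains.\<close>

lemma frobenius_reciprocity:
  assumes \<rho>: "\<And>g x. g \<in> carrier G \<Longrightarrow> x \<in> carrier G \<Longrightarrow> \<rho> (x \<otimes> g \<otimes> inv x) = \<rho> g"
  shows "char_pairing G (induced_character G H \<pi>) \<rho> = char_pairing K \<pi> \<rho>"
proof -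
  \<comment> \<open>Extension of \<open>\<pi>\<close> by zero, which absorbs the case distinction in
    the induced character and lets sums run over all of \<open>G\<close>.\<close>
  define \<pi>0 where "\<pi>0 = (\<lambda>g. if g \<in> H then \<pi> g else 0)"
  have "(\<Sum>g\<in>carrier G. induced_character G H \<pi> g * \<rho> (inv g))
      = (\<Sum>g\<in>carrier G. \<Sum>x\<in>carrier G. \<pi>0 (inv x \<otimes> g \<otimes> x) * \<rho> (inv g)) / of_nat (card H)"
    unfolding induced_character_def \<pi>0_def
    by (simp add: sum_divide_distrib sum_distrib_right)
  also have "(\<Sum>g\<in>carrier G. \<Sum>x\<in>carrier G. \<pi>0 (inv x \<otimes> g \<otimes> x) * \<rho> (inv g))
      = (\<Sum>x\<in>carrier G. \<Sum>g\<in>carrier G. \<pi>0 (inv x \<otimes> g \<otimes> x) * \<rho> (inv g))"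
    by (rule sum.swap)
  also have "\<dots> = (\<Sum>x\<in>carrier G. \<Sum>g\<in>carrier G. \<pi>0 g * \<rho> (inv g))"
  proof (rule sum.cong[OF refl])
    fix x assume x: "x \<in> carrier G"
    have "(\<Sum>g\<in>carrier G. \<pi>0 (inv x \<otimes> g \<otimes> x) * \<rho> (inv g))
        = (\<Sum>g\<in>carrier G. \<pi>0 (inv x \<otimes> g \<otimes> inv (inv x)) * \<rho> (inv (inv x \<otimes> g \<otimes> inv (inv x))))"
    proof (intro sum.cong refl)
      fix g assume g: "g \<in> carrier G"
      have "\<rho> (inv g) = \<rho> (inv x \<otimes> inv g \<otimes> inv (inv x))"
        using \<rho>[of "inv g" "inv x"] x g by simp
      also have "inv x \<otimes> inv g \<otimes> inv (inv x) = inv (inv x \<otimes> g \<otimes> inv (inv x))"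
        using x g by (simp add: inv_mult_group m_assoc)
      finally show "\<pi>0 (inv x \<otimes> g \<otimes> x) * \<rho> (inv g)
          = \<pi>0 (inv x \<otimes> g \<otimes> inv (inv x)) * \<rho> (inv (inv x \<otimes> g \<otimes> inv (inv x)))"
        using x by simp
    qed
    also have "\<dots> = (\<Sum>g\<in>carrier G. \<pi>0 g * \<rho> (inv g))"
      using sum_conjugate[of "inv x" "\<lambda>g. \<pi>0 g * \<rho> (inv g)"] x by simp
    finally show "(\<Sum>g\<in>carrier G. \<pi>0 (inv x \<otimes> g \<otimes> x) * \<rho> (inv g))
        = (\<Sum>g\<in>carrier G. \<pi>0 g * \<rho> (inv g))" .
  qed
  also have "\<dots> = of_nat (card (carrier G)) * (\<Sum>g\<in>carrier G. \<pi>0 g * \<rho> (inv g))" by simp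
  also have "(\<Sum>g\<in>carrier G. \<pi>0 g * \<rho> (inv g)) = (\<Sum>g\<in>H. \<pi> g * \<rho> (inv\<^bsub>K\<^esub> g))"
    using subset by (intro sum.mono_neutral_cong_right) (auto simp: \<pi>0_def inv_K)
  finally show ?thesis
    unfolding char_pairing_def by simp
qed

section \<open>The induced character and its multiplicities\<close>

lemma induced_character_conjugate:
  assumes g: "g \<in> carrier G" and h: "h \<in> carrier G"
  shows "induced_character G H \<pi> (h \<otimes> g \<otimes> inv h) = induced_character G H \<pi> g"
proof -
  define \<pi>0 where "\<pi>0 = (\<lambda>g. if g \<in> H then \<pi> g else 0)"
  have "(\<Sum>x\<in>carrier G. \<pi>0 (inv x \<otimes> (h \<otimes> g \<otimes> inv h) \<otimes> x))
      = (\<Sum>x\<in>carrier G. \<pi>0 (inv (h \<otimes> x) \<otimes> (h \<otimes> g \<otimes> inv h) \<otimes> (h \<otimes> x)))"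
    using sum_left_translate[OF h, of "\<lambda>x. \<pi>0 (inv x \<otimes> (h \<otimes> g \<otimes> inv h) \<otimes> x)"] by simp
  also have "\<dots> = (\<Sum>x\<in>carrier G. \<pi>0 (inv x \<otimes> g \<otimes> x))"
  proof (intro sum.cong refl arg_cong[where f = \<pi>0])
    fix x assume x: "x \<in> carrier G"
    show "inv (h \<otimes> x) \<otimes> (h \<otimes> g \<otimes> inv h) \<otimes> (h \<otimes> x) = inv x \<otimes> g \<otimes> x"
      using x g h by (simp add: inv_mult_group m_assoc cancel_inv)
  qed
  finally show ?thesis
    using g h unfolding induced_character_def \<pi>0_def by simp
qed

text \<open>All \<open>|G|\<close> conjugates of the identity lie in \<open>H\<close>, and
  \<open>|G| / |H|\<close> is the index by Lagrange's theorem.\<close>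

lemma induced_character_one:
  "induced_character G H \<pi> \<one> = of_nat (card (rcosets H)) * \<pi> \<one>"
proof -
  have "(\<Sum>x\<in>carrier G. if inv x \<otimes> \<one> \<otimes> x \<in> H then \<pi> (inv x \<otimes> \<one> \<otimes> x) else 0)
      = of_nat (card (carrier G)) * \<pi> \<one>"
    by simp
  also have "card (carrier G) = card (rcosets H) * card H"
    using lagrange_finite[OF fin subgroup_axioms] unfolding Coset.order_def by simp
  finally show ?thesis
    unfolding induced_character_def using finite_H subgroup_nonempty by (auto simp: card_gt_0_iff)
qed

text \<open>Reciprocity and symmetry turn the pairing into one of the restriction of
  \<open>\<rho>\<close> with \<open>\<pi>\<close> over \<open>K\<close>, which counts constituents.
  In particular it is a natural number.\<close>

lemma pairing_induced_character:
  assumes \<pi>: "\<pi> \<in> Irr K" and \<rho>: "\<rho> \<in> Irr G"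
    and cs: "set cs \<subseteq> Irr K" "\<And>h. h \<in> H \<Longrightarrow> \<rho> h = (\<Sum>\<pi>\<leftarrow>cs. \<pi> h)"
  shows "char_pairing G (induced_character G H \<pi>) \<rho> = of_nat (count_list cs \<pi>)"
proof -
  have "char_pairing G (induced_character G H \<pi>) \<rho> = char_pairing K \<pi> \<rho>"
    by (rule frobenius_reciprocity) (rule Irr_conjugate[OF \<rho>])
  also have "\<dots> = char_pairing K \<rho> \<pi>" by (rule K.char_pairing_commute)
  also have "\<dots> = char_pairing K (\<lambda>h. \<Sum>\<pi>\<leftarrow>cs. \<pi> h) \<pi>"
    by (rule char_pairing_cong) (simp add: cs(2))
  also have "\<dots> = of_nat (count_list cs \<pi>)" by (rule K.char_pairing_sum_list[OF cs(1) \<pi>])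
  finally show ?thesis .
qed

text \<open>The induced character is a class function, hence expands in \<open>Irr G\<close> with
  its pairings as coefficients. These are natural numbers by restricting each \<open>\<chi>\<close>,
  so they are the multiplicities.\<close>

lemma of_nat_induced_multiplicity:
  assumes \<pi>: "\<pi> \<in> Irr K" and \<rho>: "\<rho> \<in> Irr G"
  shows "of_nat (induced_multiplicity G H \<rho> \<pi>) = char_pairing G (induced_character G H \<pi>) \<rho>"
proof -
  have "\<exists>m. char_pairing G (induced_character G H \<pi>) \<chi> = of_nat m" if \<chi>: "\<chi> \<in> Irr G" for \<chi>
    using restrict_Irr[OF \<chi>] pairing_induced_character[OF \<pi> \<chi>] by metis
  then obtain m where m: "\<And>\<chi>. \<chi> \<in> Irr G \<Longrightarrow> char_pairing G (induced_character G H \<pi>) \<chi> = of_nat (m \<chi>)"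
    by metis
  have "irr_multiplicities G (induced_character G H \<pi>) \<rho> = m \<rho>"
    using m class_function_expansion[of "induced_character G H \<pi>"] induced_character_conjugate \<rho>
    by (intro irr_multiplicities_eq_pairing) auto
  then show ?thesis unfolding induced_multiplicity_def using m[OF \<rho>] by simp
qed

text \<open>The decomposition of the restriction of \<open>\<rho>\<close>, evaluated at the
  identity.\<close>

lemma char_degree_restrict:
  assumes \<rho>: "\<rho> \<in> Irr G"
  shows "char_degree G \<rho> = (\<Sum>\<pi>\<in>Irr K. real (induced_multiplicity G H \<rho> \<pi>) * char_degree K \<pi>)"
proof -
  obtain cs where cs: "set cs \<subseteq> Irr K" "\<And>h. h \<in> H \<Longrightarrow> \<rho> h = (\<Sum>\<pi>\<leftarrow>cs. \<pi> h)"
    using restrict_Irr[OF \<rho>] by blast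
  have m: "induced_multiplicity G H \<rho> \<pi> = count_list cs \<pi>" if "\<pi> \<in> Irr K" for \<pi>
    using of_nat_induced_multiplicity[OF that \<rho>] pairing_induced_character[OF that \<rho> cs] by simp
  have "\<rho> \<one> = (\<Sum>\<pi>\<in>Irr K. of_nat (count_list cs \<pi>) * \<pi> \<one>)"
    using cs(2)[OF one_closed] K.sum_list_Irr[OF cs(1)] by simp
  then show ?thesis unfolding char_degree_def by (simp add: m)
qed

text \<open>The degree of the induced character is the sum of multiplicity times degree over
  \<open>Irr G\<close>. All terms are nonnegative, so the one for \<open>\<rho>\<close> is at most
  the total.\<close>

lemma induced_multiplicity_degree_le:
  assumes \<pi>: "\<pi> \<in> Irr K" and \<rho>: "\<rho> \<in> Irr G"
  shows "real (induced_multiplicity G H \<rho> \<pi>) * char_degree G \<rho>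
    \<le> real (card (rcosets H)) * char_degree K \<pi>"
proof -
  have "of_nat (card (rcosets H)) * \<pi> \<one>
      = (\<Sum>\<chi>\<in>Irr G. of_nat (induced_multiplicity G H \<chi> \<pi>) * \<chi> \<one>)"
    using class_function_expansion[of "induced_character G H \<pi>" \<one>] induced_character_conjugate
    by (simp add: of_nat_induced_multiplicity[OF \<pi>] induced_character_one)
  then have "real (card (rcosets H)) * char_degree K \<pi>
      = (\<Sum>\<chi>\<in>Irr G. real (induced_multiplicity G H \<chi> \<pi>) * char_degree G \<chi>)"
    unfolding char_degree_def by (drule_tac arg_cong[where f = Re]) simp
  also have "\<dots> \<ge> real (induced_multiplicity G H \<rho> \<pi>) * char_degree G \<rho>"
    by (rule member_le_sum) (use \<rho> finite_Irr char_degree_pos in \<open>auto simp: less_imp_le\<close>)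
  finally show ?thesis .
qed

section \<open>Choice of the constituent and the two lower bounds\<close>

lemma exists_large_constituent:
  assumes \<rho>: "\<rho> \<in> Irr G"
    and deg: "char_degree G \<rho> \<ge> sqrt (real (card (carrier G))) / a"
  shows "\<exists>\<pi>\<in>Irr K. char_degree K \<pi> \<ge> sqrt (real (card H)) / (a * real (k_number K)) \<and>
    real (induced_multiplicity G H \<rho> \<pi>) \<ge> sqrt (real (card (rcosets H))) / (a * real (k_number K))"
proof -
  define r k where "r = char_degree G \<rho>" and "k = real (card (Irr K))"
  define i h where "i = sqrt (real (card (rcosets H)))" and "h = sqrt (real (card H))"
  have r: "r > 0" unfolding r_def by (rule char_degree_pos[OF \<rho>])
  have "card (carrier G) = card (rcosets H) * card H"
    using lagrange_finite[OF fin subgroup_axioms] unfolding Coset.order_def by simp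
  then have ih: "sqrt (real (card (carrier G))) = i * h"
    unfolding i_def h_def by (simp add: real_sqrt_mult)
  have "Irr K \<noteq> {}" using r char_degree_restrict[OF \<rho>] unfolding r_def by auto
  then have card: "card (Irr K) > 0" using K.finite_Irr card_gt_0_iff by blast
  \<comment> \<open>Averaging: if all \<open>k\<close> terms in the degree formula were below
    \<open>r / k\<close>, their sum would be below \<open>r\<close>.\<close>
  obtain \<pi> where \<pi>: "\<pi> \<in> Irr K"
    and large: "r / k \<le> real (induced_multiplicity G H \<rho> \<pi>) * char_degree K \<pi>"
  proof (rule ccontr)
    assume "\<not> thesis"
    then have small: "real (induced_multiplicity G H \<rho> \<pi>) * char_degree K \<pi> < r / k"
      if "\<pi> \<in> Irr K" for \<pi>
      using that \<open>\<And>\<pi>. \<pi> \<in> Irr K \<Longrightarrow> r / k \<le> _ \<pi> \<Longrightarrow> thesis\<close> by (meson not_le)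
    have "r = (\<Sum>\<pi>\<in>Irr K. real (induced_multiplicity G H \<rho> \<pi>) * char_degree K \<pi>)"
      unfolding r_def by (rule char_degree_restrict[OF \<rho>])
    also have "\<dots> < real (card (Irr K)) * (r / k)"
      by (rule sum_bounded_above_strict[OF small card])
    also have "\<dots> = r" using card unfolding k_def by simp
    finally show False by simp
  qed
  define c d where "c = real (induced_multiplicity G H \<rho> \<pi>)" and "d = char_degree K \<pi>"
  have k: "k > 0" unfolding k_def using card by simp
  have d: "d > 0" unfolding d_def by (rule K.char_degree_pos[OF \<pi>])
  have c: "c \<ge> 0" unfolding c_def by simp
  have "i * h / a \<le> r" using deg unfolding ih r_def .
  then have "i * h / a / k \<le> r / k" by (rule divide_right_mono) (use k in simp)
  with large have cd: "i * h / (a * k) \<le> c * d" unfolding c_def d_def by simp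
  have dh: "d \<le> h" unfolding d_def h_def using K.char_degree_le_sqrt[OF \<pi>] by simp
  have h: "h > 0" using d dh by simp
  have "c * d \<le> r"
    unfolding c_def d_def r_def char_degree_restrict[OF \<rho>]
    by (rule member_le_sum) (use \<pi> K.finite_Irr K.char_degree_pos in \<open>auto simp: less_imp_le\<close>)
  \<comment> \<open>Multiplying by \<open>c\<close> brings in the bound on \<open>c * r\<close> from
    the induced degree; cancelling \<open>d > 0\<close> leaves \<open>c\<close> squared at most the
    index.\<close>
  then have "c * (c * d) \<le> c * r" using c by (rule mult_left_mono)
  also have "\<dots> \<le> i\<^sup>2 * d"
    using induced_multiplicity_degree_le[OF \<pi> \<rho>] unfolding c_def r_def d_def i_def by simp
  finally have "c\<^sup>2 \<le> i\<^sup>2" using d by (simp add: power2_eq_square mult.assoc[symmetric])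
  then have ci: "c \<le> i" by (rule power2_le_imp_le) (simp add: i_def)
  have "i > 0"
    unfolding i_def using \<open>card (carrier G) = _\<close> by (cases "card (rcosets H) = 0") auto
  \<comment> \<open>Each lower bound comes from the one on \<open>c * d\<close> by replacing the
    other factor with its upper bound, here \<open>d \<le> h\<close> and below
    \<open>c \<le> i\<close>, and cancelling it.\<close>
  have "h * (i / (a * k)) \<le> h * c"
    using cd mult_left_mono[OF dh c] by (simp add: mult.commute)
  then have "i / (a * k) \<le> c" using h by (rule mult_left_le_imp_le)
  moreover have "i * (h / (a * k)) \<le> i * d"
    using cd mult_right_mono[OF ci] d by (simp add: less_imp_le order_trans)
  then have "h / (a * k) \<le> d" using \<open>i > 0\<close> by (rule mult_left_le_imp_le)
  ultimately show ?thesis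
    using \<pi> unfolding c_def d_def i_def h_def k_def k_number_def by blast
qed

end

theorem theorem1p4:
  fixes G :: "('a, 'b) monoid_scheme" and H :: "'a set"
    and \<rho> :: "'a \<Rightarrow> complex" and a :: real
  assumes "group G" and "finite (carrier G)"
    and "subgroup H G"
    and "\<rho> \<in> Irr G"
    and "a \<ge> 1"
    and "char_degree G \<rho> \<ge> sqrt (real (card (carrier G))) / a"
  shows "\<exists>\<pi> \<in> Irr (G\<lparr>carrier := H\<rparr>).
      char_degree (G\<lparr>carrier := H\<rparr>) \<pi>
        \<ge> sqrt (real (card H)) / (a * real (k_number (G\<lparr>carrier := H\<rparr>))) \<and>
      real (induced_multiplicity G H \<rho> \<pi>)
        \<ge> sqrt (real (card (rcosets\<^bsub>G\<^esub> H))) / (a * real (k_number (G\<lparr>carrier := H\<rparr>)))"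
proof -
  interpret group G by fact
  interpret finite_group_subgroup G H
    using assms(1-3) by (intro finite_group_subgroup.intro finite_group.intro finite_group_axioms.intro)
  show ?thesis by (rule exists_large_constituent) (use assms in auto)
qed

end
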